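(* Let $(\mu_t)_{t>0}$ be a family of Borel probability measures on $\mathbb R^d$. The following two properties are equivalent: (1) there exists $h_0>0$ such that $$\sup_{h\in(0,h_0)}\frac1h\Big(\int_{\mathbb R^d}(1\wedge|y|^2)\,\mu_h(dy)+\Big|\int_{\{|y|\le1\}}y\,\mu_h(dy)\Big|\Big)<\infty;$$ (2) every null sequence in $(0,\infty)$ has a subsequence $(h_n)_{n\in\mathbb N}$ for which there exist a Lévy triplet $(b,\sigma,\nu)$ and a constant $c\ge0$ such that $$\lim_{n\to\infty}\int_{\mathbb R^d}\frac{f(x+y)-f(x)}{h_n}\,\mu_{h_n}(dy)=\big(L_{(b,\sigma,\nu)}f\big)(x)-c\,f(x)\quad\text{for all }f\in C_c^2(\mathbb R^d)\text{ and }x\in\mathbb R^d.$$ If, in addition to (1), for every $\varepsilon>0$ there exists $M_\varepsilon>0$ with $\limsup_{h\downarrow0}\frac1h\,\mu_h(\{y\in\mathbb R^d:|y|>M_\varepsilon\})<\varepsilon$, then $c=0$ in (2).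
   Context: $d\in\mathbb N$; $|\cdot|$ is the Euclidean norm. A null sequence in $(0,\infty)$ is a sequence of positive reals converging to $0$. $C_c^2(\mathbb R^d)$ is the space of twice continuously differentiable real functions with compact support; $C_b^2(\mathbb R^d)$ is the space of functions whose partial derivatives up to order 2 are bounded and continuous. A Lévy triplet $(b,\sigma,\nu)$ consists of $b\in\mathbb R^d$, a symmetric positive semidefinite $\sigma\in\mathbb R^{d\times d}$, and a Lévy measure $\nu$, i.e. a Borel measure on $\mathbb R^d$ with $\nu(\{0\})=0$ and $\int(1\wedge|y|^2)\,\nu(dy)<\infty$. For $f\in C_b^2(\mathbb R^d)$, $$(L_{(b,\sigma,\nu)}f)(x)=\langle b,\nabla f(x)\rangle+\tfrac12\operatorname{tr}(\sigma\nabla^2f(x))+\int_{\mathbb R^d\setminus\{0\}}\Big(f(x+y)-f(x)-\langle\nabla f(x),y\rangle\mathbf 1_{\{|y|\le1\}}\Big)\,\nu(dy).$$ *)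

theory Defs
  imports "HOL-Probability.Probability"
begin

definition gradient :: "(real ^ 'n \<Rightarrow> real) \<Rightarrow> real ^ 'n \<Rightarrow> real ^ 'n" where
  "gradient f x = (\<chi> i. frechet_derivative f (at x) (axis i 1))"

definition hessian :: "(real ^ 'n \<Rightarrow> real) \<Rightarrow> real ^ 'n \<Rightarrow> real ^ 'n ^ 'n" where
  "hessian f x = jacobian (gradient f) (at x)"

definition twice_cont_diff :: "(real ^ 'n \<Rightarrow> real) \<Rightarrow> bool" where
  "twice_cont_diff f \<longleftrightarrow>
     (\<forall>x. f differentiable (at x)) \<and> (\<forall>x. gradient f differentiable (at x)) \<and>
     continuous_on UNIV (hessian f)"

definition Cc2 :: "(real ^ 'n \<Rightarrow> real) set" where
  "Cc2 = {f. twice_cont_diff f \<and> compact (closure {x. f x \<noteq> 0})}"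

definition sym_psd :: "real ^ 'n ^ 'n \<Rightarrow> bool" where
  "sym_psd \<sigma> \<longleftrightarrow> transpose \<sigma> = \<sigma> \<and> (\<forall>x. x \<bullet> (\<sigma> *v x) \<ge> 0)"

definition levy_measure :: "(real ^ 'n) measure \<Rightarrow> bool" where
  "levy_measure \<nu> \<longleftrightarrow>
     sets \<nu> = sets borel \<and> emeasure \<nu> {0} = 0 \<and>
     (\<integral>\<^sup>+ y. ennreal (min 1 ((norm y)\<^sup>2)) \<partial>\<nu>) < \<infinity>"

definition levy_triplet :: "real ^ 'n \<Rightarrow> real ^ 'n ^ 'n \<Rightarrow> (real ^ 'n) measure \<Rightarrow> bool" where
  "levy_triplet b \<sigma> \<nu> \<longleftrightarrow> sym_psd \<sigma> \<and> levy_measure \<nu>"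

(* The integrand is \<nu>-integrable whenever f is C^2 with f and its partial derivatives up to
   order 2 bounded; outside that class the default value 0 of a non-convergent Bochner
   integral may enter. *)
definition levy_operator ::
    "real ^ 'n \<Rightarrow> real ^ 'n ^ 'n \<Rightarrow> (real ^ 'n) measure \<Rightarrow> (real ^ 'n \<Rightarrow> real) \<Rightarrow> real ^ 'n \<Rightarrow> real" where
  "levy_operator b \<sigma> \<nu> f x =
     b \<bullet> gradient f x + 1 / 2 * trace (\<sigma> ** hessian f x) +
     (LINT y : UNIV - {0} | \<nu>.
        f (x + y) - f x - (gradient f x \<bullet> y) * indicator {y. norm y \<le> 1} y)"

definition null_seq :: "(nat \<Rightarrow> real) \<Rightarrow> bool" where
  "null_seq h \<longleftrightarrow> (\<forall>n. h n > 0) \<and> h \<longlonglongrightarrow> 0"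

definition generator_limit ::
    "(real \<Rightarrow> (real ^ 'n) measure) \<Rightarrow> (nat \<Rightarrow> real) \<Rightarrow>
     real ^ 'n \<Rightarrow> real ^ 'n ^ 'n \<Rightarrow> (real ^ 'n) measure \<Rightarrow> real \<Rightarrow> bool" where
  "generator_limit \<mu> h b \<sigma> \<nu> c \<longleftrightarrow>
     (\<forall>f\<in>Cc2. \<forall>x.
        (\<lambda>n. LINT y | \<mu> (h n). (f (x + y) - f x) / h n)
          \<longlonglongrightarrow> levy_operator b \<sigma> \<nu> f x - c * f x)"

end

theory Submission
  imports Defs
begin

text \<open>
  Given (1), the measures \<open>\<rho>\<^sub>n(dy) = (1 \<and> |y|\<^sup>2) \<mu>\<^sub>h(dy) / h\<close> with \<open>h = h\<^sub>n\<close> have bounded mass, so a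
  subsequence converges vaguely to some \<open>R\<close>; the truncated means and second moments divided by \<open>h\<close>
  converge along a further subsequence. Subtracting from \<open>f (x + y) - f x\<close> its second-order Taylor
  polynomial in the truncated \<open>y\<close>, dividing by \<open>1 \<and> |y|\<^sup>2\<close> and adding \<open>f x\<close> gives a continuous function
  of compact support, so the difference quotient converges. Then \<open>\<nu> = R / (1 \<and> |y|\<^sup>2)\<close> off the origin, \<open>\<sigma>\<close>
  is the limiting second moment minus that of \<open>\<nu>\<close>, and \<open>c\<close> is the mass lost at infinity.

  Conversely, \<open>f y = max 0 (1 - |y|\<^sup>2)^3\<close> satisfies \<open>f 0 - f y \<ge> 1 \<and> |y|\<^sup>2\<close>, and \<open>y\<^sub>i f y\<close> agrees with
  \<open>y\<^sub>i\<close> on the unit ball up to \<open>3 (1 \<and> |y|\<^sup>2)\<close>; testing the limit at \<open>x = 0\<close> with them bounds the moments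
  along the subsequence. Rescaling \<open>f\<close> to ever larger balls and testing at \<open>0\<close> isolates \<open>c\<close>, which the
  tail condition forces to vanish.
\<close>

section \<open>Vague compactness of measures on Euclidean space\<close>

text \<open>The terms after index \<open>j\<close> add up to at most a third of
  \<open>(1/4) ^ j\<close>, so the leading term cannot be cancelled: at least two thirds of it
  survive. In base 2 the tail could cancel it completely.\<close>

lemma quaternary_series_lower_bound:
  fixes d :: "nat \<Rightarrow> real"
  assumes bound: "\<And>i. \<bar>d i\<bar> \<le> 1" and zero: "\<And>i. i < j \<Longrightarrow> d i = 0" and lead: "\<bar>d j\<bar> = 1"
  shows "(1/4) ^ j / 2 \<le> \<bar>\<Sum>i. d i * (1/4) ^ i\<bar>"
proof -
  have geo: "summable (\<lambda>i. (1/4::real) ^ i)"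
    by (rule summable_geometric) simp
  have le: "norm (d i * (1/4) ^ i) \<le> (1/4) ^ i" for i
    using mult_right_mono[OF bound[of i], of "(1/4) ^ i"] by (simp add: abs_mult)
  have summ: "summable (\<lambda>i. d i * (1/4) ^ i)"
    using geo le by (rule summable_comparison_test'[where N = 0])
  have tail: "norm (\<Sum>i. d (i + Suc j) * (1/4) ^ (i + Suc j)) \<le> (\<Sum>i. (1/4) ^ Suc j * (1/4) ^ i)"
  proof (rule norm_suminf_le)
    show "norm (d (i + Suc j) * (1/4) ^ (i + Suc j)) \<le> (1/4) ^ Suc j * (1/4) ^ i" for i
      using le[of "i + Suc j"] by (simp only: power_add mult.commute)
    show "summable (\<lambda>i. (1/4) ^ Suc j * (1/4::real) ^ i)"
      using geo by (rule summable_mult)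
  qed
  have geo_sum: "(\<Sum>i. (1/4) ^ Suc j * (1/4) ^ i) = (1/3) * (1/4::real) ^ j"
    using suminf_mult[OF geo, of "(1/4) ^ Suc j"] suminf_geometric[of "1/4::real"] by simp
  have "(\<Sum>i. d i * (1/4) ^ i) = (\<Sum>i. d (i + Suc j) * (1/4) ^ (i + Suc j)) + d j * (1/4) ^ j"
    using suminf_split_initial_segment[OF summ, of "Suc j"] zero by (simp add: sum.lessThan_Suc)
  moreover have "\<bar>d j * (1/4) ^ j\<bar> = (1/4) ^ j"
    using lead by (simp add: abs_mult)
  moreover have "0 < (1/4::real) ^ j" by simp
  ultimately show ?thesis
    using tail geo_sum unfolding real_norm_def by linarith
qed

text \<open>A point is encoded by its membership bits in a countable basis, read as base-4 digits. By
  compactness, finitely many bits locate a point up to \<open>\<epsilon>\<close>, although the encoding is only Borel.\<close>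

lemma compact_uniform_real_encoding:
  fixes K :: "'a::{metric_space, second_countable_topology} set"
  assumes "compact K"
  obtains s :: "'a \<Rightarrow> real" where "s \<in> borel_measurable borel" "\<And>x. 0 \<le> s x \<and> s x \<le> 4/3"
    "\<And>\<epsilon>. \<epsilon> > 0 \<Longrightarrow> \<exists>\<delta>>0. \<forall>x\<in>K. \<forall>y\<in>K. \<bar>s x - s y\<bar> < \<delta> \<longrightarrow> dist x y < \<epsilon>"
proof -
  obtain B :: "'a set set" where B: "countable B" "topological_basis B"
    using ex_countable_basis by blast
  define U where "U = from_nat_into B"
  have B_ne: "B \<noteq> {}"
    using topological_basisE[OF B(2) open_UNIV UNIV_I] by blast
  have openU: "open (U i)" for i
    using from_nat_into[OF B_ne] B(2) by (simp add: U_def topological_basis_open)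
  have rangeU: "range U = B"
    by (simp add: U_def B_ne B(1) range_from_nat_into)
  define s :: "'a \<Rightarrow> real" where "s x = (\<Sum>i. indicator (U i) x * (1/4) ^ i)" for x
  have geo: "summable (\<lambda>i. (1/4::real) ^ i)"
    by (rule summable_geometric) simp
  have term_le: "indicator (U i) x * (1/4) ^ i \<le> (1/4::real) ^ i" for i x
    by (simp add: indicator_def)
  have summ: "summable (\<lambda>i. indicator (U i) x * (1/4::real) ^ i)" for x
    using geo by (rule summable_comparison_test'[where N = 0]) (simp add: indicator_def)
  show thesis
  proof
    have [measurable]: "U i \<in> sets borel" for i
      using openU by simp
    show "s \<in> borel_measurable borel"
      unfolding s_def by measurable
    show "0 \<le> s x \<and> s x \<le> 4/3" for x
      using suminf_nonneg[OF summ] suminf_le[OF term_le summ geo] suminf_geometric[of "1/4::real"]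
      by (simp add: s_def)
    fix \<epsilon> :: real assume "\<epsilon> > 0"
    \<comment> \<open>Only basis sets of small diameter are kept. They still cover \<open>K\<close>,
      so finitely many of them do, and membership in these finitely many sets decides
      proximity.\<close>
    define I where "I = {i. \<forall>x\<in>U i. \<forall>y\<in>U i. dist x y < \<epsilon>}"
    have "K \<subseteq> (\<Union>i\<in>I. U i)"
    proof
      fix x assume "x \<in> K"
      obtain V where V: "V \<in> B" "x \<in> V" "V \<subseteq> ball x (\<epsilon>/2)"
        using topological_basisE[OF B(2) open_ball, of x x "\<epsilon>/2"] \<open>\<epsilon> > 0\<close> by auto
      then obtain i where i: "V = U i"
        using rangeU by auto
      have "i \<in> I"
        unfolding I_def mem_Collect_eq
      proof (intro ballI)
        fix y z assume "y \<in> U i" "z \<in> U i"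
        then have "dist x y < \<epsilon>/2" "dist x z < \<epsilon>/2"
          using V(3) i by (auto simp: subset_eq)
        then show "dist y z < \<epsilon>"
          using dist_triangle_half_r by blast
      qed
      then show "x \<in> (\<Union>i\<in>I. U i)"
        using V(2) i by blast
    qed
    then obtain D where D: "D \<subseteq> I" "finite D" "K \<subseteq> (\<Union>i\<in>D. U i)"
      using compactE_image[OF assms, of I U] openU by metis
    then obtain N where N: "\<And>i. i \<in> D \<Longrightarrow> i < N"
      using finite_nat_bounded by (metis lessThan_iff subsetD)
    show "\<exists>\<delta>>0. \<forall>x\<in>K. \<forall>y\<in>K. \<bar>s x - s y\<bar> < \<delta> \<longrightarrow> dist x y < \<epsilon>"
    proof (intro exI conjI ballI impI)
      \<comment> \<open>This is the gap from the lower bound: codes whose first differing digit has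
        index below \<open>N\<close> are at least this far apart, so closer codes share all digits
        that belong to the finite cover.\<close>
      show "(1/4) ^ N / 2 > (0::real)" by simp
      fix x y assume xy: "x \<in> K" "y \<in> K" and close: "\<bar>s x - s y\<bar> < (1/4) ^ N / 2"
      define d where "d i = indicator (U i) x - (indicator (U i) y :: real)" for i
      have diff: "s x - s y = (\<Sum>i. d i * (1/4) ^ i)"
        unfolding s_def d_def using suminf_diff[OF summ summ, of x y] by (simp add: left_diff_distrib)
      have agree: "d i = 0" if "i < N" for i
      proof (rule ccontr)
        assume "d i \<noteq> 0"
        then have "\<exists>j. d j \<noteq> 0 \<and> (\<forall>k<j. \<not> d k \<noteq> 0)"
          using exists_least_iff[of "\<lambda>i. d i \<noteq> 0"] by blast
        then obtain j where j: "d j \<noteq> 0" "\<And>k. k < j \<Longrightarrow> d k = 0"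
          by blast
        have "j \<le> i"
          using j(2)[of i] \<open>d i \<noteq> 0\<close> by (cases "i < j") auto
        have "(1/4) ^ j / 2 \<le> \<bar>\<Sum>i. d i * (1/4) ^ i\<bar>"
          using j by (intro quaternary_series_lower_bound) (auto simp: d_def indicator_def split: if_splits)
        moreover have "(1/4) ^ N \<le> (1/4::real) ^ j"
          using \<open>j \<le> i\<close> that by (intro power_decreasing) auto
        ultimately show False
          using close unfolding diff by linarith
      qed
      obtain i where i: "i \<in> D" "x \<in> U i"
        using D(3) xy(1) by blast
      have "y \<in> U i"
        using agree[OF N[OF i(1)]] i(2) unfolding d_def by (cases "y \<in> U i") simp_all
      then show "dist x y < \<epsilon>"
        using i D(1) unfolding I_def by blast
    qed
  qed
qed

text \<open>This reduces weak compactness of measures on \<open>K\<close> to Helly's selection theorem on the line: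
  push measures forward along the Borel map \<open>s\<close>, and pull test functions back along the
  continuous map \<open>T\<close>.\<close>

lemma convex_compact_real_section:
  fixes K :: "'a::euclidean_space set"
  assumes "compact K" "convex K" "K \<noteq> {}"
  obtains s :: "'a \<Rightarrow> real" and T :: "real \<Rightarrow> 'a"
  where "s \<in> borel_measurable borel" "\<And>x. 0 \<le> s x \<and> s x \<le> 4/3"
    "continuous_on UNIV T" "range T \<subseteq> K" "\<And>x. x \<in> K \<Longrightarrow> T (s x) = x"
proof -
  obtain s :: "'a \<Rightarrow> real" where s: "s \<in> borel_measurable borel" "\<And>x. 0 \<le> s x \<and> s x \<le> 4/3"
    and sep: "\<And>\<epsilon>. \<epsilon> > 0 \<Longrightarrow> \<exists>\<delta>>0. \<forall>x\<in>K. \<forall>y\<in>K. \<bar>s x - s y\<bar> < \<delta> \<longrightarrow> dist x y < \<epsilon>"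
    using compact_uniform_real_encoding[OF assms(1)] by blast
  have inj: "inj_on s K"
  proof (rule inj_onI)
    fix x y assume xy: "x \<in> K" "y \<in> K" "s x = s y"
    then have "dist x y < \<epsilon>" if "\<epsilon> > 0" for \<epsilon>
      using sep[OF that] by force
    then show "x = y"
      by (metis dist_pos_lt less_irrefl)
  qed
  define t where "t = inv_into K s"
  have ts: "t (s x) = x" if "x \<in> K" for x
    using inj that by (simp add: t_def)
  have "uniformly_continuous_on (s ` K) t"
    unfolding uniformly_continuous_on_def
  proof (intro allI impI)
    fix \<epsilon> :: real assume "\<epsilon> > 0"
    then obtain \<delta> where \<delta>: "\<delta> > 0" "\<forall>x\<in>K. \<forall>y\<in>K. \<bar>s x - s y\<bar> < \<delta> \<longrightarrow> dist x y < \<epsilon>"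
      using sep by blast
    then show "\<exists>d>0. \<forall>x\<in>s ` K. \<forall>x'\<in>s ` K. dist x' x < d \<longrightarrow> dist (t x') (t x) < \<epsilon>"
      by (intro exI[of _ \<delta>]) (auto simp: ts dist_real_def)
  qed
  then obtain g where g: "uniformly_continuous_on (closure (s ` K)) g" "\<And>x. x \<in> s ` K \<Longrightarrow> t x = g x"
    by (rule uniformly_continuous_on_extension_on_closure) blast
  have cont_g: "continuous_on (closure (s ` K)) g"
    using g(1) by (rule uniformly_continuous_imp_continuous)
  have "g ` (s ` K) \<subseteq> K"
  proof (intro image_subsetI)
    fix v assume "v \<in> s ` K"
    then show "g v \<in> K"
      using g(2)[of v] ts by force
  qed
  then have "g ` closure (s ` K) \<subseteq> K"
    using image_closure_subset[OF cont_g compact_imp_closed[OF assms(1)]] by blast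
  moreover have "closedin (top_of_set UNIV) (closure (s ` K))"
    by simp
  \<comment> \<open>Dugundji's theorem extends to the whole line with values kept in
    \<open>K\<close>; this is where convexity of \<open>K\<close> enters.\<close>
  ultimately obtain T where T: "continuous_on UNIV T" "range T \<subseteq> K" "\<And>x. x \<in> closure (s ` K) \<Longrightarrow> T x = g x"
    using Dugundji[OF assms(2,3) _ cont_g, of UNIV] by blast
  have "T (s x) = x" if "x \<in> K" for x
  proof -
    have "s x \<in> s ` K"
      using that by (rule imageI)
    then show ?thesis
      using T(3)[OF subsetD[OF closure_subset]] g(2) ts[OF that] by metis
  qed
  then show thesis
    using that s T by blast
qed

lemma bounded_if_vanishes_outside_cball:
  fixes \<phi> :: "'a::euclidean_space \<Rightarrow> real"
  assumes "continuous_on UNIV \<phi>" and zero: "\<And>y. R \<le> norm y \<Longrightarrow> \<phi> y = 0"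
  obtains B where "\<And>y. norm (\<phi> y) \<le> B"
proof -
  have "bounded (\<phi> ` cball 0 R)"
    using assms(1) by (intro compact_imp_bounded compact_continuous_image) (auto intro: continuous_on_subset)
  then obtain B where B: "\<And>y. y \<in> cball 0 R \<Longrightarrow> norm (\<phi> y) \<le> B"
    unfolding bounded_iff by blast
  have "norm (\<phi> y) \<le> max B 0" for y
    using B[of y] zero[of y] by (cases "norm y \<le> R") auto
  then show thesis
    by (rule that)
qed

lemma tight_if_common_bounded_support:
  fixes P :: "nat \<Rightarrow> real measure"
  assumes "\<And>n. real_distribution (P n)" and "a < b" and "\<And>n. measure (P n) {a<..b} = 1"
  shows "tight P"
  unfolding tight_def using assms by (metis diff_add_cancel less_add_same_cancel1)

text \<open>The map \<open>y \<mapsto> y / (1 + norm y)\<close> places the space inside the closed unit ball, whose boundary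
  absorbs the escaping mass \<open>m - measure M UNIV\<close>.\<close>

lemma vague_sequential_compactness:
  fixes \<rho> :: "nat \<Rightarrow> 'a::euclidean_space measure"
  assumes fin: "\<And>n. finite_measure (\<rho> n)" and sets[measurable_cong]: "\<And>n. sets (\<rho> n) = sets borel"
    and bound: "\<And>n. measure (\<rho> n) UNIV \<le> K"
  obtains r m M where "strict_mono (r :: nat \<Rightarrow> nat)" "finite_measure M" "sets M = sets borel"
    "(\<lambda>n. measure (\<rho> (r n)) UNIV) \<longlonglongrightarrow> m" "measure M UNIV \<le> m"
    "\<And>(\<phi> :: 'a \<Rightarrow> real) R. continuous_on UNIV \<phi> \<Longrightarrow> (\<And>y. R \<le> norm y \<Longrightarrow> \<phi> y = 0) \<Longrightarrow>
      (\<lambda>n. integral\<^sup>L (\<rho> (r n)) \<phi>) \<longlonglongrightarrow> integral\<^sup>L M \<phi>"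
proof -
  interpret finite_measure "\<rho> n" for n
    by (rule fin)
  have space[simp]: "space (\<rho> n) = UNIV" for n
    using sets_eq_imp_space_eq[OF sets] by simp
  define mass where "mass n = measure (\<rho> n) UNIV" for n
  have mass: "0 \<le> mass n" "mass n \<le> K" for n
    by (simp_all add: mass_def bound)
  have "bounded (range mass)"
    using mass by (intro boundedI[of _ K]) auto
  then obtain m r0 where r0: "strict_mono r0" "(mass \<circ> r0) \<longlonglongrightarrow> m"
    using bounded_imp_convergent_subsequence by blast
  have "0 \<le> m"
    using r0(2) by (rule LIMSEQ_le_const) (auto simp: mass)
  obtain s :: "'a \<Rightarrow> real" and T :: "real \<Rightarrow> 'a" where s[measurable]: "s \<in> borel_measurable borel"
    and s_range: "\<And>x. 0 \<le> s x \<and> s x \<le> 4/3"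
    and T: "continuous_on UNIV T" "range T \<subseteq> cball 0 1" "\<And>x. x \<in> cball 0 1 \<Longrightarrow> T (s x) = x"
  proof -
    have "cball (0::'a) 1 \<noteq> {}"
      by simp
    from convex_compact_real_section[OF compact_cball convex_cball this] show thesis
      using that by blast
  qed
  have T_meas[measurable]: "T \<in> borel_measurable borel"
    using T(1) by (rule borel_measurable_continuous_onI)
  define j where "j y = (1 / (1 + norm y)) *\<^sub>R y" for y :: 'a
  \<comment> \<open>Inverse of \<open>j\<close> on the open ball. On the unit sphere
    \<open>1 / 0 = 0\<close> gives the value 0, which is harmless since \<open>D\<close> below
    assigns weight 0 to those points.\<close>
  define J where "J z = (1 / (1 - norm z)) *\<^sub>R z" for z :: 'a
  have J_meas[measurable]: "J \<in> borel_measurable borel"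
    unfolding J_def by measurable
  have nz: "1 + norm y \<noteq> 0" for y :: 'a
    by (smt (verit) norm_ge_zero)
  have norm_j: "norm (j y) = norm y / (1 + norm y)" for y
    by (simp add: j_def add_nonneg_nonneg)
  have j_lt: "norm (j y) < 1" for y
    unfolding norm_j by (simp add: add_pos_nonneg)
  have one_minus: "1 - norm (j y) = 1 / (1 + norm y)" for y
    unfolding norm_j using nz[of y] by (simp add: field_simps)
  have Jj: "J (j y) = y" for y
    unfolding J_def one_minus using nz[of y] by (simp add: j_def)
  define e where "e y = s (j y)" for y
  have e_meas[measurable]: "e \<in> borel_measurable borel"
    unfolding e_def j_def by measurable
  have Te: "T (e y) = j y" for y
    using T(3)[of "j y"] j_lt[of y] by (simp add: e_def)
  \<comment> \<open>A zero measure cannot be normalised, so an arbitrary point mass stands in. The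
    identity \<open>P_integral\<close> survives because both of its sides are then 0.\<close>
  define P where "P n = (if mass n = 0 then return borel 0
    else distr (density (\<rho> n) (\<lambda>_. ennreal (1 / mass n))) borel e)" for n
  have P_dist: "real_distribution (P n)" for n
  proof (cases "mass n = 0")
    case True
    then show ?thesis
      by (simp add: P_def real_distribution_def real_distribution_axioms_def prob_space_return)
  next
    case False
    then have "mass n > 0"
      using mass(1)[of n] by simp
    have "prob_space (density (\<rho> n) (\<lambda>_. ennreal (1 / mass n)))"
    proof
      have "emeasure (\<rho> n) UNIV = ennreal (mass n)"
        by (simp add: emeasure_eq_measure mass_def)
      then show "emeasure (density (\<rho> n) (\<lambda>_. ennreal (1 / mass n)))
          (space (density (\<rho> n) (\<lambda>_. ennreal (1 / mass n)))) = 1"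
        using \<open>mass n > 0\<close> by (simp add: emeasure_density ennreal_mult[symmetric])
    qed
    then show ?thesis
      using False by (auto simp: P_def intro!: prob_space.real_distribution_distr)
  qed
  have P_integral: "(LINT y|\<rho> n. \<psi> (e y)) = mass n * integral\<^sup>L (P n) \<psi>"
    if [measurable]: "\<psi> \<in> borel_measurable borel" for n and \<psi> :: "real \<Rightarrow> real"
  proof (cases "mass n = 0")
    case True
    then have "emeasure (\<rho> n) UNIV = 0"
      by (simp add: emeasure_eq_measure mass_def)
    then have "AE y in \<rho> n. \<psi> (e y) = 0"
      by (intro AE_I[of _ _ UNIV]) auto
    then show ?thesis
      using True integral_eq_zero_AE by simp
  next
    case False
    then have "integral\<^sup>L (P n) \<psi> = integral\<^sup>L (density (\<rho> n) (\<lambda>_. ennreal (1 / mass n))) (\<lambda>y. \<psi> (e y))"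
      by (simp add: P_def integral_distr)
    also have "\<dots> = (LINT y|\<rho> n. (1 / mass n) *\<^sub>R \<psi> (e y))"
      using mass(1)[of n] by (intro integral_density) auto
    finally show ?thesis
      using False by simp
  qed
  have supp: "measure (P n) {-1<..2} = 1" for n
  proof -
    interpret Pn: real_distribution "P n"
      by (rule P_dist)
    have "emeasure (P n) (- {-1<..2}) = 0"
    proof (cases "mass n = 0")
      case False
      have "-1 < e y \<and> e y \<le> 2" for y
        using s_range[of "j y"] unfolding e_def by linarith
      then have "e -` (- {-1<..2}) = {}"
        by auto
      then show ?thesis
        using False by (simp add: P_def emeasure_distr)
    qed (simp add: P_def)
    then have "AE x in P n. x \<in> {-1<..2}"
      by (intro AE_I[of _ _ "- {-1<..2}"]) auto
    then show ?thesis
      by (subst Pn.prob_eq_1) auto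
  qed
  have "tight P"
    using P_dist _ supp by (rule tight_if_common_bounded_support) simp
  then obtain r1 \<Lambda> where r1: "strict_mono r1" "real_distribution \<Lambda>" "weak_conv_m (P \<circ> r0 \<circ> r1) \<Lambda>"
    using tight_imp_convergent_subsubsequence r0(1) by blast
  interpret \<Lambda>: real_distribution \<Lambda>
    by (rule r1(2))
  \<comment> \<open>The factor \<open>m\<close> undoes the normalisation in the limit. The indicator
    drops what the weak limit puts over the unit sphere, that is, the mass that has escaped to
    infinity.\<close>
  define D where "D t = m * indicator {t. norm (T t) < 1} t" for t
  have D_meas[measurable]: "D \<in> borel_measurable borel"
    unfolding D_def by measurable
  have D_bounds: "0 \<le> D t" "D t \<le> m" for t
    using \<open>0 \<le> m\<close> by (auto simp: D_def indicator_def)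
  define M where "M = distr (density \<Lambda> (\<lambda>t. ennreal (D t))) borel (\<lambda>t. J (T t))"
  have mass_M: "emeasure M UNIV \<le> ennreal m"
  proof -
    have "emeasure M UNIV = (\<integral>\<^sup>+ t. ennreal (D t) \<partial>\<Lambda>)"
      by (simp add: M_def emeasure_distr emeasure_density)
    also have "\<dots> \<le> (\<integral>\<^sup>+ t. ennreal m \<partial>\<Lambda>)"
      using D_bounds by (intro nn_integral_mono ennreal_leI)
    finally show ?thesis
      by (simp add: \<Lambda>.emeasure_space_1[simplified])
  qed
  have M_sets: "sets M = sets borel"
    by (simp add: M_def)
  have M_space: "space M = UNIV"
    using sets_eq_imp_space_eq[OF M_sets] by simp
  have M_fin: "finite_measure M"
  proof
    show "emeasure M (space M) \<noteq> \<infinity>"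
      using mass_M unfolding M_space by (auto simp: top_unique)
  qed
  show thesis
  proof
    show "strict_mono (r0 \<circ> r1)"
      using r0(1) r1(1) by (rule strict_mono_o)
    show "finite_measure M" "sets M = sets borel"
      by fact+
    have mass_lim: "(\<lambda>n. mass ((r0 \<circ> r1) n)) \<longlonglongrightarrow> m"
      using LIMSEQ_subseq_LIMSEQ[OF r0(2) r1(1)] by (simp add: comp_def)
    then show "(\<lambda>n. measure (\<rho> ((r0 \<circ> r1) n)) UNIV) \<longlonglongrightarrow> m"
      by (simp add: mass_def)
    show "measure M UNIV \<le> m"
      using mass_M \<open>0 \<le> m\<close> by (simp add: measure_def enn2real_leI)
    fix \<phi> :: "'a \<Rightarrow> real" and R
    assume cont: "continuous_on UNIV \<phi>" and zero: "\<And>y. R \<le> norm y \<Longrightarrow> \<phi> y = 0"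
    define R' where "R' = max R 0"
    obtain B where \<phi>_bound: "\<And>y. norm (\<phi> y) \<le> B"
      using bounded_if_vanishes_outside_cball[OF cont zero] by blast
    \<comment> \<open>Keeping the denominator away from 0 makes this continuous across the sphere.
      Within the closed ball nothing else changes: where the cutoff acts, the argument has norm at
      least \<open>R\<close>, so \<open>\<phi>\<close> vanishes there.\<close>
    define \<phi>' where "\<phi>' z = \<phi> ((1 / max (1 - norm z) (1 / (1 + R'))) *\<^sub>R z)" for z
    have R': "0 \<le> R'" "R \<le> R'"
      by (simp_all add: R'_def)
    have pos: "0 < max (1 - norm z) (1 / (1 + R'))" for z :: 'a
      using R'(1) by (simp add: less_max_iff_disj)
    have cont': "continuous_on UNIV \<phi>'"
      unfolding \<phi>'_def
      by (rule continuous_on_compose2[OF cont])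
         (use pos in \<open>auto intro!: continuous_intros simp: less_imp_neq[symmetric]\<close>)
    have \<phi>'_J: "\<phi>' z = indicator {z. norm z < 1} z * \<phi> (J z)" if "norm z \<le> 1" for z
    proof (cases "1 / (1 + R') \<le> 1 - norm z")
      case True
      then have "norm z < 1"
        using R'(1) by (smt (verit) zero_less_divide_1_iff)
      then show ?thesis
        using True by (simp add: \<phi>'_def J_def max_def)
    next
      case False
      have big: "R' / (1 + R') < norm z"
        using False R' by (simp add: field_simps)
      have "max (1 - norm z) (1 / (1 + R')) = 1 / (1 + R')"
        using False by simp
      then have "\<phi>' z = \<phi> ((1 + R') *\<^sub>R z)"
        by (simp add: \<phi>'_def)
      moreover have "R' \<le> (1 + R') * norm z"
        using big R' by (simp add: field_simps)
      then have "R \<le> norm ((1 + R') *\<^sub>R z)"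
        using R' by simp
      ultimately have "\<phi>' z = 0"
        using zero by simp
      moreover have "\<phi> (J z) = 0" if "norm z < 1"
      proof (rule zero)
        have "R' \<le> norm z / (1 - norm z)"
          using big that R' by (simp add: field_simps)
        then show "R \<le> norm (J z)"
          using that R'(2) by (simp add: J_def)
      qed
      ultimately show ?thesis
        by (auto simp: indicator_def)
    qed
    define \<psi> where "\<psi> t = \<phi>' (T t)" for t
    have cont_\<psi>: "continuous_on UNIV \<psi>"
      unfolding \<psi>_def using cont' T(1) by (rule continuous_on_compose2) simp
    then have [measurable]: "\<psi> \<in> borel_measurable borel"
      by (rule borel_measurable_continuous_onI)
    have [measurable]: "\<phi> \<in> borel_measurable borel"
      using cont by (rule borel_measurable_continuous_onI)
    have \<psi>_e: "\<psi> (e y) = \<phi> y" for y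
      using \<phi>'_J[of "j y"] j_lt[of y] by (simp add: \<psi>_def Te Jj)
    have lhs: "integral\<^sup>L (\<rho> n) \<phi> = mass n * integral\<^sup>L (P n) \<psi>" for n
      using P_integral[of \<psi> n] by (simp add: \<psi>_e)
    have "(\<lambda>n. integral\<^sup>L ((P \<circ> r0 \<circ> r1) n) \<psi>) \<longlonglongrightarrow> integral\<^sup>L \<Lambda> \<psi>"
    proof (rule weak_conv_imp_integral_bdd_continuous_conv[OF _ r1(2,3)])
      show "real_distribution ((P \<circ> r0 \<circ> r1) n)" for n
        by (simp add: P_dist)
      show "isCont \<psi> t" for t
        using cont_\<psi> by (simp add: continuous_on_eq_continuous_at)
      show "norm (\<psi> t) \<le> B" for t
        by (simp add: \<psi>_def \<phi>'_def \<phi>_bound[unfolded real_norm_def])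
    qed
    then have "(\<lambda>n. mass ((r0 \<circ> r1) n) * integral\<^sup>L (P ((r0 \<circ> r1) n)) \<psi>) \<longlonglongrightarrow> m * integral\<^sup>L \<Lambda> \<psi>"
      using mass_lim by (intro tendsto_mult) (simp_all add: comp_def)
    moreover have "m * integral\<^sup>L \<Lambda> \<psi> = integral\<^sup>L M \<phi>"
    proof -
      have "integral\<^sup>L M \<phi> = integral\<^sup>L (density \<Lambda> (\<lambda>t. ennreal (D t))) (\<lambda>t. \<phi> (J (T t)))"
        unfolding M_def by (rule integral_distr) simp_all
      also have "\<dots> = (LINT t|\<Lambda>. D t *\<^sub>R \<phi> (J (T t)))"
        using D_bounds by (intro integral_density) auto
      also have "\<dots> = (LINT t|\<Lambda>. m * \<psi> t)"
        using T(2) by (intro Bochner_Integration.integral_cong)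
          (auto simp: D_def \<psi>_def \<phi>'_J image_subset_iff indicator_def)
      finally show ?thesis
        by simp
    qed
    ultimately show "(\<lambda>n. integral\<^sup>L (\<rho> ((r0 \<circ> r1) n)) \<phi>) \<longlonglongrightarrow> integral\<^sup>L M \<phi>"
      by (simp add: lhs)
  qed
qed

section \<open>Taylor expansion and test functions\<close>

lemma has_derivative_gradient:
  fixes f :: "real ^ 'n \<Rightarrow> real"
  assumes "f differentiable (at x)"
  shows "(f has_derivative (\<lambda>v. gradient f x \<bullet> v)) (at x)"
proof -
  have works: "(f has_derivative frechet_derivative f (at x)) (at x)"
    using assms frechet_derivative_works by blast
  then have lin: "linear (frechet_derivative f (at x))"
    by (rule has_derivative_linear)
  have "frechet_derivative f (at x) v = gradient f x \<bullet> v" for v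
  proof -
    have "frechet_derivative f (at x) v = frechet_derivative f (at x) (\<Sum>i\<in>UNIV. v $ i *\<^sub>R axis i 1)"
      using basis_expansion[of v] by (simp add: scalar_mult_eq_scaleR)
    also have "\<dots> = (\<Sum>i\<in>UNIV. v $ i * frechet_derivative f (at x) (axis i 1))"
      by (simp add: linear_sum[OF lin] linear_cmul[OF lin])
    finally show ?thesis
      by (simp add: inner_vec_def gradient_def mult.commute)
  qed
  then show ?thesis
    using works by (metis (no_types, lifting) ext)
qed

lemma gradient_unique:
  fixes f :: "real ^ 'n \<Rightarrow> real"
  assumes "(f has_derivative (\<lambda>v. g \<bullet> v)) (at x)"
  shows "gradient f x = g"
  by (simp add: gradient_def vec_eq_iff inner_axis frechet_derivative_at[OF assms, symmetric])

lemma hessian_unique: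
  fixes f :: "real ^ 'n \<Rightarrow> real"
  assumes "(gradient f has_derivative H) (at x)"
  shows "hessian f x = matrix H"
  by (simp add: hessian_def jacobian_def frechet_derivative_at[OF assms, symmetric])

lemma has_derivative_hessian:
  fixes f :: "real ^ 'n \<Rightarrow> real"
  assumes "gradient f differentiable (at x)"
  shows "(gradient f has_derivative (\<lambda>v. hessian f x *v v)) (at x)"
  using assms jacobian_works unfolding hessian_def by blast

lemma Cc2_continuous: "f \<in> Cc2 \<Longrightarrow> continuous_on UNIV f"
  by (auto simp: Cc2_def twice_cont_diff_def continuous_on_eq_continuous_within
      intro: differentiable_imp_continuous_within)

text \<open>The mean value theorem is applied on the segment from \<open>x\<close> to
  \<open>x + y\<close> to \<open>f\<close> minus its quadratic Taylor polynomial. The derivative of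
  that difference is the linearisation error of the gradient at \<open>x\<close>, paired with
  \<open>y\<close>, hence of order o(|y|^2).\<close>

lemma second_order_taylor:
  fixes f :: "real ^ 'n \<Rightarrow> real"
  assumes "twice_cont_diff f"
  shows "((\<lambda>y. (f (x + y) - f x - gradient f x \<bullet> y - 1/2 * (y \<bullet> (hessian f x *v y))) / (norm y)\<^sup>2) \<longlongrightarrow> 0) (at 0)"
proof (rule tendstoI)
  fix \<epsilon> :: real assume "\<epsilon> > 0"
  define H where "H = hessian f x"
  have "(gradient f has_derivative (\<lambda>v. H *v v)) (at x)"
    using assms has_derivative_hessian by (auto simp: twice_cont_diff_def H_def)
  then obtain \<delta> where \<delta>: "\<delta> > 0"
    "\<And>z. norm (z - x) < \<delta> \<Longrightarrow> norm (gradient f z - gradient f x - H *v (z - x)) \<le> \<epsilon>/2 * norm (z - x)"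
    unfolding has_derivative_at_alt using \<open>\<epsilon> > 0\<close> by (meson half_gt_zero)
  have small: "\<bar>f (x + y) - f x - gradient f x \<bullet> y - 1/2 * (y \<bullet> (H *v y))\<bar> \<le> \<epsilon>/2 * (norm y)\<^sup>2"
    if "norm y < \<delta>" for y
  proof -
    define g where "g t = f (x + t *\<^sub>R y) - t * (gradient f x \<bullet> y) - t\<^sup>2 / 2 * (y \<bullet> (H *v y))" for t
    define g' where "g' t = gradient f (x + t *\<^sub>R y) \<bullet> y - gradient f x \<bullet> y - t * (y \<bullet> (H *v y))" for t
    have "DERIV g t :> g' t" for t
    proof -
      have "(f has_derivative (\<lambda>v. gradient f (x + t *\<^sub>R y) \<bullet> v)) (at (x + t *\<^sub>R y))"
        using assms by (intro has_derivative_gradient) (simp add: twice_cont_diff_def)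
      then have "((\<lambda>t. f (x + t *\<^sub>R y)) has_derivative (\<lambda>h. gradient f (x + t *\<^sub>R y) \<bullet> (h *\<^sub>R y))) (at t)"
        by (rule has_derivative_compose[rotated]) (auto intro!: derivative_eq_intros)
      then have [derivative_intros]:
        "DERIV (\<lambda>t. f (x + t *\<^sub>R y)) t :> gradient f (x + t *\<^sub>R y) \<bullet> y"
        by (simp add: has_field_derivative_def mult_commute_abs)
      show ?thesis
        unfolding g_def g'_def by (auto intro!: derivative_eq_intros)
    qed
    then obtain t where t: "0 < t" "t < 1" "g 1 - g 0 = (1 - 0) * g' t"
      using MVT2[of 0 1 g g'] by auto
    have "g' t = (gradient f (x + t *\<^sub>R y) - gradient f x - H *v ((x + t *\<^sub>R y) - x)) \<bullet> y"
      by (simp add: g'_def inner_diff_left inner_diff_right matrix_vector_mult_scaleR inner_commute)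
    also have "\<bar>\<dots>\<bar> \<le> norm (gradient f (x + t *\<^sub>R y) - gradient f x - H *v ((x + t *\<^sub>R y) - x)) * norm y"
      by (rule Cauchy_Schwarz_ineq2)
    also have "\<dots> \<le> (\<epsilon>/2 * norm ((x + t *\<^sub>R y) - x)) * norm y"
    proof (intro mult_right_mono \<delta>(2))
      have "\<bar>t\<bar> * norm y \<le> 1 * norm y"
        using t by (intro mult_right_mono) auto
      then show "norm ((x + t *\<^sub>R y) - x) < \<delta>"
        using that by simp
    qed simp
    also have "\<dots> \<le> \<epsilon>/2 * (norm y)\<^sup>2"
      using t \<open>\<epsilon> > 0\<close> mult_right_mono[of t 1 "\<epsilon>/2 * (norm y)\<^sup>2"] by (simp add: power2_eq_square mult_ac)
    finally have "\<bar>g' t\<bar> \<le> \<epsilon>/2 * (norm y)\<^sup>2" .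
    moreover have "f (x + y) - f x - gradient f x \<bullet> y - 1/2 * (y \<bullet> (H *v y)) = g 1 - g 0"
      by (simp add: g_def)
    ultimately show ?thesis
      using t(3) by simp
  qed
  show "\<forall>\<^sub>F y in at 0. dist ((f (x + y) - f x - gradient f x \<bullet> y - 1/2 * (y \<bullet> (hessian f x *v y))) / (norm y)\<^sup>2) 0 < \<epsilon>"
    unfolding eventually_at
  proof (intro exI conjI ballI impI)
    fix y :: "real ^ 'n" assume y: "y \<noteq> 0 \<and> dist y 0 < \<delta>"
    then have pos: "0 < (norm y)\<^sup>2"
      by simp
    have "\<bar>f (x + y) - f x - gradient f x \<bullet> y - 1/2 * (y \<bullet> (H *v y))\<bar> / (norm y)\<^sup>2 \<le> \<epsilon>/2"
      using small[of y] y pos by (simp add: pos_divide_le_eq)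
    then have "\<bar>f (x + y) - f x - gradient f x \<bullet> y - 1/2 * (y \<bullet> (H *v y))\<bar> / (norm y)\<^sup>2 < \<epsilon>"
      using \<open>\<epsilon> > 0\<close> by linarith
    then show "dist ((f (x + y) - f x - gradient f x \<bullet> y - 1/2 * (y \<bullet> (hessian f x *v y))) / (norm y)\<^sup>2) 0 < \<epsilon>"
      by (simp add: H_def abs_divide)
  qed (rule \<delta>(1))
qed

section \<open>Explicit twice differentiable test functions\<close>

text \<open>An exponent of at least 2 smooths the kink: at the origin the difference quotient is
  \<open>max 0 h ^ Suc n\<close>, which tends to 0.\<close>

lemma DERIV_max_0_power:
  "DERIV (\<lambda>t::real. max 0 t ^ Suc (Suc n)) t :> real (Suc (Suc n)) * max 0 t ^ Suc n"
proof (cases t "0::real" rule: linorder_cases)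
  case less
  have "DERIV (\<lambda>t::real. 0) t :> real (Suc (Suc n)) * max 0 t ^ Suc n"
    using less by simp
  then show ?thesis
    by (rule has_field_derivative_transform_within_open[where S = "{..<0}"]) (use less in auto)
next
  case equal
  have "(\<lambda>h::real. max 0 h ^ Suc n) \<midarrow>0\<rightarrow> max 0 0 ^ Suc n"
    by (intro tendsto_intros)
  moreover have "(max 0 (0 + h) ^ Suc (Suc n) - max 0 0 ^ Suc (Suc n)) / h = max 0 h ^ Suc n" if "h \<noteq> 0" for h :: real
    using that by (cases "h > 0") auto
  then have "\<forall>\<^sub>F h :: real in at 0. (max 0 (0 + h) ^ Suc (Suc n) - max 0 0 ^ Suc (Suc n)) / h = max 0 h ^ Suc n"
    unfolding eventually_at_filter by (intro always_eventually) blast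
  ultimately have "(\<lambda>h::real. (max 0 (0 + h) ^ Suc (Suc n) - max 0 0 ^ Suc (Suc n)) / h) \<midarrow>0\<rightarrow> max 0 0 ^ Suc n"
    by (subst tendsto_cong)
  then show ?thesis
    unfolding DERIV_def equal by simp
next
  case greater
  have "DERIV (\<lambda>t::real. t ^ Suc (Suc n)) t :> real (Suc (Suc n)) * max 0 t ^ Suc n"
    using greater DERIV_pow[of "Suc (Suc n)" t] by (simp add: mult.commute)
  then show ?thesis
    by (rule has_field_derivative_transform_within_open[where S = "{0<..}"]) (use greater in auto)
qed

text \<open>Cubing the positive part makes these compactly supported functions twice continuously
  differentiable while all derivatives stay explicit.\<close>

definition bump :: "real \<Rightarrow> real ^ 'n \<Rightarrow> real \<Rightarrow> real ^ 'n \<Rightarrow> real" where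
  "bump a u k y = (a + u \<bullet> y) * max 0 (1 - k * (y \<bullet> y)) ^ 3"

lemma has_derivative_max_power:
  fixes y :: "real ^ 'n"
  shows "((\<lambda>y. max 0 (1 - k * (y \<bullet> y)) ^ Suc (Suc n)) has_derivative
     (\<lambda>v. - (2 * k * (y \<bullet> v)) * (real (Suc (Suc n)) * max 0 (1 - k * (y \<bullet> y)) ^ Suc n))) (at y)"
  by (rule DERIV_compose_FDERIV[OF DERIV_max_0_power])
     (auto intro!: derivative_eq_intros simp: inner_commute fun_eq_iff algebra_simps)

lemma gradient_bump:
  fixes u :: "real ^ 'n" and k :: real
  defines "m \<equiv> \<lambda>y :: real ^ 'n. max 0 (1 - k * (y \<bullet> y))"
  shows "(bump a u k has_derivative (\<lambda>v. (m y ^ 3 *\<^sub>R u - (6 * k * (a + u \<bullet> y) * m y ^ 2) *\<^sub>R y) \<bullet> v)) (at y)"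
proof -
  have "((\<lambda>y. m y ^ 3) has_derivative (\<lambda>v. - (2 * k * (y \<bullet> v)) * (3 * m y ^ 2))) (at y)"
    using has_derivative_max_power[of k 1 y] by (simp add: m_def numeral_eq_Suc)
  moreover have "bump a u k = (\<lambda>y. (a + u \<bullet> y) * m y ^ 3)"
    by (simp add: bump_def m_def fun_eq_iff)
  ultimately show ?thesis
    by (simp only:, intro has_derivative_eq_rhs[OF has_derivative_mult[OF _ \<open>((\<lambda>y. m y ^ 3) has_derivative _) (at y)\<close>]])
       (auto intro!: derivative_eq_intros simp: fun_eq_iff algebra_simps)
qed

lemma hessian_bump:
  fixes u :: "real ^ 'n" and k :: real
  defines "m \<equiv> \<lambda>y :: real ^ 'n. max 0 (1 - k * (y \<bullet> y))"
  shows "(gradient (bump a u k) has_derivative (\<lambda>v. - (6 * k * (y \<bullet> v) * m y ^ 2) *\<^sub>R u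
      + (24 * k\<^sup>2 * (a + u \<bullet> y) * m y * (y \<bullet> v) - 6 * k * (u \<bullet> v) * m y ^ 2) *\<^sub>R y
      - (6 * k * (a + u \<bullet> y) * m y ^ 2) *\<^sub>R v)) (at y)"
proof -
  have grad: "gradient (bump a u k) = (\<lambda>y. m y ^ 3 *\<^sub>R u - (6 * k * (a + u \<bullet> y) * m y ^ 2) *\<^sub>R y)"
    unfolding m_def by (rule ext gradient_unique gradient_bump)+
  have 3: "((\<lambda>y. m y ^ 3) has_derivative (\<lambda>v. - (2 * k * (y \<bullet> v)) * (3 * m y ^ 2))) (at y)"
    using has_derivative_max_power[of k 1 y] by (simp add: m_def numeral_eq_Suc)
  have 2: "((\<lambda>y. m y ^ 2) has_derivative (\<lambda>v. - (2 * k * (y \<bullet> v)) * (2 * m y))) (at y)"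
    using has_derivative_max_power[of k 0 y] by (simp add: m_def numeral_eq_Suc)
  \<comment> \<open>The product rule is proved for abstract factors \<open>p\<close> and
    \<open>q\<close>, so that the powers of \<open>m\<close> enter only through their known
    derivatives.\<close>
  have "((\<lambda>y. p y *\<^sub>R u - (6 * k * (a + u \<bullet> y) * q y) *\<^sub>R y) has_derivative
      (\<lambda>v. p' v *\<^sub>R u - ((6 * k * (a + u \<bullet> y) * q y) *\<^sub>R v
        + (6 * k * (a + u \<bullet> y) * q' v + 6 * k * (u \<bullet> v) * q y) *\<^sub>R y))) (at y)"
    if [derivative_intros]: "(p has_derivative p') (at y)" "(q has_derivative q') (at y)" for p q p' q'
    by (auto intro!: derivative_eq_intros)
  from this[OF 3 2] show ?thesis
    unfolding grad by (rule has_derivative_eq_rhs)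
      (simp add: fun_eq_iff algebra_simps power2_eq_square flip: scaleR_add_left scaleR_diff_left scaleR_minus_left)
qed

lemma bump_in_Cc2:
  assumes "k > 0"
  shows "bump a (u :: real ^ 'n) k \<in> Cc2"
proof -
  have "hessian (bump a u k) y $ i $ j =
    (- (6 * k * y $ j * max 0 (1 - k * (y \<bullet> y)) ^ 2) *\<^sub>R u
      + (24 * k\<^sup>2 * (a + u \<bullet> y) * max 0 (1 - k * (y \<bullet> y)) * y $ j
         - 6 * k * u $ j * max 0 (1 - k * (y \<bullet> y)) ^ 2) *\<^sub>R y
      - (6 * k * (a + u \<bullet> y) * max 0 (1 - k * (y \<bullet> y)) ^ 2) *\<^sub>R axis j 1) $ i" for y i j
    unfolding hessian_unique[OF hessian_bump] by (simp add: matrix_def inner_axis)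
  then have "continuous_on UNIV (\<lambda>y. \<chi> i j. hessian (bump a u k) y $ i $ j)"
    by (auto intro!: continuous_intros)
  then have "continuous_on UNIV (hessian (bump a u k))"
    by simp
  moreover have "bump a u k differentiable (at y)" "gradient (bump a u k) differentiable (at y)" for y
    using gradient_bump hessian_bump differentiableI by blast+
  moreover have "compact (closure {y. bump a u k y \<noteq> 0})"
    unfolding compact_closure
  proof (rule boundedI)
    fix y assume "y \<in> {y. bump a u k y \<noteq> 0}"
    then have "k * (y \<bullet> y) < 1"
      by (auto simp: bump_def max_def split: if_splits)
    then have "(norm y)\<^sup>2 \<le> (sqrt (1 / k))\<^sup>2"
      using assms by (simp add: dot_square_norm field_simps)
    then show "norm y \<le> sqrt (1 / k)"
      using assms by (meson norm_ge_zero power2_le_imp_le real_sqrt_ge_zero less_imp_le zero_le_divide_1_iff)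
  qed
  ultimately show ?thesis
    by (simp add: Cc2_def twice_cont_diff_def)
qed

section \<open>Consequences of generator convergence\<close>

lemma bump_measurable[measurable]: "bump a (u :: real ^ 'n) k \<in> borel_measurable borel"
  unfolding bump_def by measurable

text \<open>With \<open>p = max 0 (1 - k * |y|^2)\<close> the truncated square is
  \<open>1 - p\<close> and the bump is \<open>p ^ 3\<close>; the factorisation
  \<open>1 - p ^ 3 = (1 - p) * (1 + p + p ^ 2)\<close> gives the constant 3. Thus one test function
  stands for the truncated second moment up to constants.\<close>

lemma bump_one_bounds:
  assumes "k > 0"
  shows "min 1 (k * (norm y)\<^sup>2) \<le> 1 - bump 1 0 k y"
    and "1 - bump 1 0 k y \<le> 3 * min 1 (k * (norm y)\<^sup>2)"
proof -
  define p where "p = max 0 (1 - k * (norm y)\<^sup>2)"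
  have p: "0 \<le> p" "p \<le> 1"
    using assms by (auto simp: p_def)
  have min_p: "min 1 (k * (norm y)\<^sup>2) = 1 - p" and bump_p: "bump 1 0 k y = p ^ 3"
    by (auto simp: p_def bump_def dot_square_norm)
  have sq: "p\<^sup>2 \<le> 1"
    using p by (simp add: power_le_one)
  have "1 - p ^ 3 = (1 - p) * (1 + p + p\<^sup>2)"
    by (simp add: power2_eq_square power3_eq_cube algebra_simps)
  also have "\<dots> \<le> (1 - p) * 3"
    using p sq by (intro mult_left_mono) auto
  finally show "1 - bump 1 0 k y \<le> 3 * min 1 (k * (norm y)\<^sup>2)"
    by (simp add: min_p bump_p)
  have "p ^ 3 \<le> p ^ 1"
    using p by (intro power_decreasing) auto
  then show "min 1 (k * (norm y)\<^sup>2) \<le> 1 - bump 1 0 k y"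
    by (simp add: min_p bump_p)
qed

text \<open>On the unit ball the error is \<open>y $ i\<close> times
  \<open>1 - bump 1 0 1 y\<close>, and the first factor is at most 1. Outside, both functions
  vanish.\<close>

lemma bump_linear_approx:
  fixes y :: "real ^ 'n"
  shows "\<bar>indicator {y. norm y \<le> 1} y * y $ i - bump 0 (axis i 1) 1 y\<bar> \<le> 3 * min 1 ((norm y)\<^sup>2)"
proof (cases "norm y \<le> 1")
  case True
  have comp: "\<bar>y $ i\<bar> \<le> 1"
    using component_le_norm_cart[of y i] True by simp
  have bump: "bump 0 (axis i 1) 1 y = y $ i * bump 1 0 1 y"
    by (simp add: bump_def inner_axis')
  have "0 \<le> 1 - bump 1 0 1 y"
  proof -
    have "0 \<le> min 1 (1 * (norm y)\<^sup>2)"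
      by simp
    then show ?thesis
      using bump_one_bounds(1)[of 1 y] by linarith
  qed
  then have "\<bar>y $ i * (1 - bump 1 0 1 y)\<bar> \<le> 1 * (1 - bump 1 0 1 y)"
    unfolding abs_mult using comp by (intro mult_mono) auto
  also have "\<dots> \<le> 3 * min 1 ((norm y)\<^sup>2)"
    using bump_one_bounds(2)[of 1 y] by simp
  finally show ?thesis
    using True by (simp add: bump algebra_simps)
next
  case False
  then have "1 \<le> (norm y)\<^sup>2"
    by (simp add: one_le_power)
  then show ?thesis
    using False by (simp add: bump_def dot_square_norm)
qed

lemma generator_limit_bounded:
  assumes "generator_limit \<mu> h b \<sigma> \<nu> c" "f \<in> Cc2"
  obtains B where "\<And>n. \<bar>LINT y|\<mu> (h n). (f (x + y) - f x) / h n\<bar> \<le> B"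
proof -
  have "convergent (\<lambda>n. LINT y|\<mu> (h n). (f (x + y) - f x) / h n)"
    using assms unfolding generator_limit_def convergent_def by blast
  then have "Bseq (\<lambda>n. LINT y|\<mu> (h n). (f (x + y) - f x) / h n)"
    by (rule convergent_imp_Bseq)
  then show thesis
    using that unfolding Bseq_def real_norm_def by blast
qed

text \<open>This rules out a null sequence along which the moment quotient diverges: no subsequence
  of it could have a generator limit.\<close>

lemma generator_limit_imp_moments_bounded:
  fixes \<mu> :: "real \<Rightarrow> (real ^ 'n) measure"
  assumes h: "\<And>n. h n > 0"
    and prob: "\<And>n. prob_space (\<mu> (h n))" and sets[measurable_cong]: "\<And>n. sets (\<mu> (h n)) = sets borel"
    and lim: "generator_limit \<mu> h b \<sigma> \<nu> c"
  obtains B where "\<And>n. 1 / h n * ((LINT y|\<mu> (h n). min 1 ((norm y)\<^sup>2))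
    + norm (LINT y:{y. norm y \<le> 1}|\<mu> (h n). y)) \<le> B"
proof -
  interpret prob_space "\<mu> (h n)" for n
    by (rule prob)
  define w :: "real ^ 'n \<Rightarrow> real" where "w y = min 1 ((norm y)\<^sup>2)" for y
  have w_meas[measurable]: "w \<in> borel_measurable borel"
    unfolding w_def by measurable
  have w: "0 \<le> w y" "w y \<le> 1" for y
    by (auto simp: w_def)
  have int_w: "integrable (\<mu> (h n)) w" for n
    using w by (intro integrable_const_bound[where B = 1]) auto
  define f1 :: "real ^ 'n \<Rightarrow> real" where "f1 = bump 1 0 1"
  define g :: "'n \<Rightarrow> real ^ 'n \<Rightarrow> real" where "g i = bump 0 (axis i 1) 1" for i
  have meas[measurable]: "f1 \<in> borel_measurable borel" "g i \<in> borel_measurable borel" for i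
    by (auto simp: f1_def g_def)
  have f1: "w y \<le> 1 - f1 y" "1 - f1 y \<le> 3 * w y" for y
    using bump_one_bounds[of 1 y] by (auto simp: f1_def w_def)
  define I where "I y = indicator {y. norm y \<le> 1} y *\<^sub>R y" for y :: "real ^ 'n"
  have I_meas[measurable]: "I \<in> borel_measurable borel"
    unfolding I_def by measurable
  have I_g: "\<bar>I y $ i - g i y\<bar> \<le> 3 * w y" for y i
    using bump_linear_approx[of y i] by (simp add: I_def g_def w_def)
  have I_bound: "norm (I y) \<le> 1" for y
    by (auto simp: I_def indicator_def)
  have int_I: "integrable (\<mu> (h n)) I" for n
    using I_bound by (intro integrable_const_bound[where B = 1]) auto
  have int_Ii: "integrable (\<mu> (h n)) (\<lambda>y. I y $ i)" for n i
    using int_I by (rule integrable_bounded_linear[OF bounded_linear_vec_nth])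
  have int_f1: "integrable (\<mu> (h n)) f1" for n
  \<comment> \<open>The bound 4 is 1 plus three times the maximum 1 of \<open>w\<close>; the same
    count serves for \<open>g i\<close> below.\<close>
  proof (rule integrable_const_bound[where B = 4])
    have "norm (f1 y) \<le> 4" for y
      using f1[of y] w[of y] by auto
    then show "AE y in \<mu> (h n). norm (f1 y) \<le> 4"
      by simp
  qed simp
  have int_g: "integrable (\<mu> (h n)) (g i)" for n i
  proof (rule integrable_const_bound[where B = 4])
    have "norm (g i y) \<le> 4" for y
      using I_g[of y i] w[of y] order_trans[OF component_le_norm_cart I_bound, of y i]
      unfolding real_norm_def by linarith
    then show "AE y in \<mu> (h n). norm (g i y) \<le> 4"
      by simp
  qed simp
  obtain B1 where B1: "\<And>n. \<bar>LINT y|\<mu> (h n). (f1 (0 + y) - f1 0) / h n\<bar> \<le> B1"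
    using generator_limit_bounded[OF lim, of f1 0] bump_in_Cc2 by (metis f1_def zero_less_one)
  have "\<exists>B. \<forall>n. \<bar>LINT y|\<mu> (h n). (g i (0 + y) - g i 0) / h n\<bar> \<le> B" for i
    using generator_limit_bounded[OF lim, of "g i" 0] bump_in_Cc2 by (metis g_def zero_less_one)
  then obtain B where B: "\<And>i n. \<bar>LINT y|\<mu> (h n). (g i (0 + y) - g i 0) / h n\<bar> \<le> B i"
    by metis
  have "f1 0 = 1" "g i 0 = 0" for i
    by (simp_all add: f1_def g_def bump_def)
  then have B1': "\<bar>(LINT y|\<mu> (h n). f1 y - 1) / h n\<bar> \<le> B1" and B': "\<bar>(LINT y|\<mu> (h n). g i y) / h n\<bar> \<le> B i" for n i
    using B1[of n] B[of n i] by simp_all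
  have w_bound: "(LINT y|\<mu> (h n). w y) / h n \<le> B1" for n
  proof -
    have "(LINT y|\<mu> (h n). w y) \<le> (LINT y|\<mu> (h n). 1 - f1 y)"
      using int_w int_f1 f1(1) by (intro integral_mono) auto
    also have "\<dots> = - (LINT y|\<mu> (h n). f1 y - 1)"
      by (simp flip: Bochner_Integration.integral_minus)
    finally have "(LINT y|\<mu> (h n). w y) / h n \<le> - (LINT y|\<mu> (h n). f1 y - 1) / h n"
      using h[of n] by (intro divide_right_mono) auto
    then show ?thesis
      using B1'[of n] unfolding minus_divide_left[symmetric] by linarith
  qed
  \<comment> \<open>\<open>B i\<close> comes from testing with \<open>g i\<close>; the discrepancy
    between \<open>g i\<close> and the truncated coordinate is paid for by the second moment already
    bounded by \<open>B1\<close>.\<close>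
  have I_bound': "\<bar>(LINT y|\<mu> (h n). I y) $ i\<bar> / h n \<le> B i + 3 * B1" for n i
  proof -
    have "(LINT y|\<mu> (h n). I y) $ i = (LINT y|\<mu> (h n). I y $ i)"
      using integral_bounded_linear[OF bounded_linear_vec_nth int_I] by simp
    also have "\<dots> = (LINT y|\<mu> (h n). g i y) + (LINT y|\<mu> (h n). I y $ i - g i y)"
      using int_Ii int_g by simp
    also have "\<bar>\<dots>\<bar> \<le> \<bar>LINT y|\<mu> (h n). g i y\<bar> + (LINT y|\<mu> (h n). 3 * w y)"
    proof -
      have "\<bar>LINT y|\<mu> (h n). I y $ i - g i y\<bar> \<le> (LINT y|\<mu> (h n). \<bar>I y $ i - g i y\<bar>)"
        by (rule integral_abs_bound)
      also have "\<dots> \<le> (LINT y|\<mu> (h n). 3 * w y)"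
        using int_Ii int_g int_w I_g by (intro integral_mono) auto
      finally show ?thesis
        by linarith
    qed
    finally have "\<bar>(LINT y|\<mu> (h n). I y) $ i\<bar> / h n
        \<le> (\<bar>LINT y|\<mu> (h n). g i y\<bar> + (LINT y|\<mu> (h n). 3 * w y)) / h n"
      using h[of n] by (intro divide_right_mono) auto
    also have "\<dots> = \<bar>(LINT y|\<mu> (h n). g i y) / h n\<bar> + 3 * ((LINT y|\<mu> (h n). w y) / h n)"
      using h[of n] by (simp add: add_divide_distrib abs_divide)
    also have "\<dots> \<le> B i + 3 * B1"
      using B'[of n i] w_bound[of n] by linarith
    finally show ?thesis .
  qed
  show thesis
  proof
    fix n
    have "norm (LINT y|\<mu> (h n). I y) / h n \<le> (\<Sum>i\<in>UNIV. \<bar>(LINT y|\<mu> (h n). I y) $ i\<bar>) / h n"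
      using h[of n] norm_le_l1_cart by (intro divide_right_mono) (auto simp: less_imp_le)
    also have "\<dots> \<le> (\<Sum>i\<in>UNIV. B i + 3 * B1)"
      unfolding sum_divide_distrib by (intro sum_mono I_bound')
    finally show "1 / h n * ((LINT y|\<mu> (h n). min 1 ((norm y)\<^sup>2)) + norm (LINT y:{y. norm y \<le> 1}|\<mu> (h n). y))
        \<le> B1 + (\<Sum>i\<in>UNIV. B i + 3 * B1)"
      using w_bound[of n] by (simp add: w_def I_def set_lebesgue_integral_def add_divide_distrib)
  qed
qed

text \<open>The bumps flatten to the constant 1, which the operator annihilates. At the origin the
  gradient is 0, the Hessian is \<open>- 6 / real (Suc j)\<close> times the identity, and the jump
  integral vanishes by dominated convergence with majorant \<open>3 * min 1 (|y|^2)\<close>.\<close>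

lemma levy_operator_bump_tendsto_0:
  fixes b :: "real ^ 'n"
  assumes "levy_measure \<nu>"
  shows "(\<lambda>j. levy_operator b \<sigma> \<nu> (bump 1 0 (1 / real (Suc j))) 0) \<longlonglongrightarrow> 0"
proof -
  define f :: "nat \<Rightarrow> real ^ 'n \<Rightarrow> real" where "f j = bump 1 0 (1 / real (Suc j))" for j
  have sets[measurable_cong]: "sets \<nu> = sets borel"
    using assms by (simp add: levy_measure_def)
  have f_meas[measurable]: "f j \<in> borel_measurable borel" for j
    by (simp add: f_def)
  have f0: "f j 0 = 1" for j
    by (simp add: f_def bump_def)
  have grad: "gradient (f j) 0 = 0" for j
    using gradient_unique[OF gradient_bump, of 1 0 "1 / real (Suc j)" 0] by (simp add: f_def)
  have hess: "hessian (f j) 0 = matrix (\<lambda>v. (- 6 / real (Suc j)) *\<^sub>R v)" for j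
    using hessian_unique[OF hessian_bump, of 1 0 "1 / real (Suc j)" 0] by (simp add: f_def)
  have trace: "trace (\<sigma> ** hessian (f j) 0) = (- 6 / real (Suc j)) * trace \<sigma>" for j
  proof -
    define C where "C = - 6 / real (Suc j)"
    have "hessian (f j) 0 $ l $ i = (if l = i then C else 0)" for l i
      unfolding hess C_def[symmetric] by (simp add: matrix_def axis_def)
    then have "trace (\<sigma> ** hessian (f j) 0) = (\<Sum>i\<in>UNIV. \<sigma> $ i $ i * C)"
      by (simp add: trace_def matrix_matrix_mult_def if_distrib[of "(*) _"] cong: if_cong)
    also have "\<dots> = C * trace \<sigma>"
      by (simp add: trace_def sum_distrib_left mult.commute)
    finally show ?thesis
      by (simp only: C_def)
  qed
  have lim0: "(\<lambda>j. 1 / real (Suc j)) \<longlonglongrightarrow> 0"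
    using LIMSEQ_inverse_real_of_nat by (simp add: inverse_eq_divide)
  have "integrable \<nu> (\<lambda>y. min 1 ((norm y)\<^sup>2))"
    using assms by (intro integrableI_bounded) (auto simp: levy_measure_def)
  then have int_w: "integrable \<nu> (\<lambda>y. 3 * min 1 ((norm y)\<^sup>2))"
    by simp
  have "(\<lambda>j. LINT y|\<nu>. indicator (UNIV - {0}) y *\<^sub>R (f j y - 1)) \<longlonglongrightarrow> (LINT y|\<nu>. 0)"
  proof (rule integral_dominated_convergence[OF _ _ int_w])
    \<comment> \<open>The limit is written as the bump with \<open>k = 0\<close>, so that continuity
      in \<open>k\<close> proves it; that bump is constantly 1.\<close>
    have "(\<lambda>j. indicator (UNIV - {0}) y *\<^sub>R (f j y - 1)) \<longlonglongrightarrow> indicator (UNIV - {0}) y *\<^sub>R (1 * max 0 (1 - 0 * (y \<bullet> y)) ^ 3 - 1)" for y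
      unfolding f_def bump_def by (intro tendsto_intros lim0) simp
    then show "AE y in \<nu>. (\<lambda>j. indicator (UNIV - {0}) y *\<^sub>R (f j y - 1)) \<longlonglongrightarrow> 0"
      by simp
    have "norm (indicator (UNIV - {0}) y *\<^sub>R (f j y - 1)) \<le> 3 * min 1 ((norm y)\<^sup>2)" for j y
    proof -
      have "1 / real (Suc j) * (norm y)\<^sup>2 \<le> 1 * (norm y)\<^sup>2"
        by (intro mult_right_mono) auto
      then have "min 1 (1 / real (Suc j) * (norm y)\<^sup>2) \<le> min 1 ((norm y)\<^sup>2)"
        by linarith
      moreover have "0 \<le> min 1 (1 / real (Suc j) * (norm y)\<^sup>2)"
        by simp
      ultimately have "\<bar>f j y - 1\<bar> \<le> 3 * min 1 ((norm y)\<^sup>2)"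
        using bump_one_bounds[of "1 / real (Suc j)" y] unfolding f_def by simp
      then show ?thesis
        by (auto simp: indicator_def)
    qed
    then show "AE y in \<nu>. norm (indicator (UNIV - {0}) y *\<^sub>R (f j y - 1)) \<le> 3 * min 1 ((norm y)\<^sup>2)" for j
      by simp
  qed auto
  then have "(\<lambda>j. 1/2 * (- 6 * (1 / real (Suc j)) * trace \<sigma>)
      + (LINT y|\<nu>. indicator (UNIV - {0}) y *\<^sub>R (f j y - 1))) \<longlonglongrightarrow> 1/2 * (- 6 * 0 * trace \<sigma>) + (LINT y|\<nu>. 0)"
    by (intro tendsto_intros lim0)
  then show ?thesis
    unfolding f_def[symmetric] levy_operator_def
    by (simp add: grad trace f0 set_lebesgue_integral_def)
qed

text \<open>Testing at the origin with flat bumps gives the limit \<open>F j - c\<close>. The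
  quotients before the limit are bounded by the moments times \<open>k j\<close>, plus the tail
  mass. Letting first \<open>n\<close> and then \<open>j\<close> tend to infinity leaves only
  \<open>c \<le> 3 * \<epsilon>\<close>.\<close>

lemma killing_rate_eq_0:
  fixes \<mu> :: "real \<Rightarrow> (real ^ 'n) measure"
  assumes h: "\<And>n. h n > 0"
    and prob: "\<And>n. prob_space (\<mu> (h n))" and sets[measurable_cong]: "\<And>n. sets (\<mu> (h n)) = sets borel"
    and moment: "\<forall>\<^sub>F n in sequentially. 1 / h n * (LINT y|\<mu> (h n). min 1 ((norm y)\<^sup>2)) \<le> K"
    and tight: "\<And>\<epsilon>. \<epsilon> > 0 \<Longrightarrow>
      \<exists>M>0. \<forall>\<^sub>F n in sequentially. 1 / h n * measure (\<mu> (h n)) {y. norm y > M} < \<epsilon>"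
    and levy: "levy_measure \<nu>" and lim: "generator_limit \<mu> h b \<sigma> \<nu> c" and "c \<ge> 0"
  shows "c = 0"
proof -
  interpret prob_space "\<mu> (h n)" for n
    by (rule prob)
  define k where "k j = 1 / real (Suc j)" for j
  define f :: "nat \<Rightarrow> real ^ 'n \<Rightarrow> real" where "f j = bump 1 0 (k j)" for j
  have k: "k j > 0" for j
    by (simp add: k_def)
  have f_meas[measurable]: "f j \<in> borel_measurable borel" for j
    by (simp add: f_def)
  define F where "F j = levy_operator b \<sigma> \<nu> (f j) 0" for j
  have F: "F \<longlonglongrightarrow> 0"
    using levy_operator_bump_tendsto_0[OF levy, of b \<sigma>] by (simp add: F_def[abs_def] f_def k_def)
  have k0: "k \<longlonglongrightarrow> 0"
    unfolding k_def using LIMSEQ_inverse_real_of_nat by (simp add: inverse_eq_divide)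
  define a where "a j n = (LINT y|\<mu> (h n). (f j (0 + y) - f j 0) / h n)" for j n
  have a_lim: "a j \<longlonglongrightarrow> F j - c" for j
  proof -
    have "a j \<longlonglongrightarrow> levy_operator b \<sigma> \<nu> (f j) 0 - c * f j 0"
      using lim bump_in_Cc2[OF k] unfolding generator_limit_def a_def f_def by blast
    then show ?thesis
      by (simp add: F_def f_def bump_def)
  qed
  have c_le: "c \<le> 3 * \<epsilon>" if \<epsilon>: "\<epsilon> > 0" for \<epsilon>
  proof -
    obtain M where M: "M > 0" "\<forall>\<^sub>F n in sequentially. 1 / h n * measure (\<mu> (h n)) {y. norm y > M} < \<epsilon>"
      using tight[OF \<epsilon>] by blast
    \<comment> \<open>For \<open>norm y \<le> M\<close> the full square is at most \<open>L\<close>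
      times the truncated one; points beyond \<open>M\<close> are charged to the tail.\<close>
    define L where "L = max 1 (M\<^sup>2)"
    have a_bound: "\<bar>a j n\<bar> \<le> 3 * (k j * L * (1 / h n * (LINT y|\<mu> (h n). min 1 ((norm y)\<^sup>2)))
        + 1 / h n * measure (\<mu> (h n)) {y. norm y > M})" for j n
    proof -
      have int_w: "integrable (\<mu> (h n)) (\<lambda>y. min 1 ((norm y)\<^sup>2))"
        by (intro integrable_const_bound[where B = 1]) auto
      have space: "space (\<mu> (h n)) = UNIV"
        using sets_eq_imp_space_eq[OF sets] by simp
      have int_ind: "integrable (\<mu> (h n)) (indicator {y. norm y > M} :: _ \<Rightarrow> real)"
        by (intro integrable_const_bound[where B = 1]) auto
      have pt: "\<bar>f j y - 1\<bar> \<le> 3 * (k j * L * min 1 ((norm y)\<^sup>2) + indicator {y. norm y > M} y)" for y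
      proof -
        have 0: "0 \<le> min 1 (k j * (norm y)\<^sup>2)"
          using k[of j] by simp
        have 1: "min 1 (k j * (norm y)\<^sup>2) \<le> k j * L * min 1 ((norm y)\<^sup>2) + indicator {y. norm y > M} y"
        proof (cases "norm y > M")
          case True
          then show ?thesis
            using k[of j] by (simp add: L_def min.coboundedI1)
        next
          case False
          have "(norm y)\<^sup>2 \<le> L * min 1 ((norm y)\<^sup>2)"
          proof (cases "(norm y)\<^sup>2 \<le> 1")
            case True
            then show ?thesis
              using mult_right_mono[of 1 L "(norm y)\<^sup>2"] by (simp add: L_def)
          next
            case ge: False
            have "(norm y)\<^sup>2 \<le> M\<^sup>2"
              using False by (intro power_mono) auto
            then show ?thesis
              using ge by (simp add: L_def)
          qed
          then have "k j * (norm y)\<^sup>2 \<le> k j * (L * min 1 ((norm y)\<^sup>2))"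
            using k[of j] by (intro mult_left_mono) auto
          then show ?thesis
            using False by (simp add: mult.assoc min.coboundedI2)
        qed
        show ?thesis
          using order_trans[OF 0 bump_one_bounds(1)[OF k]]
            order_trans[OF bump_one_bounds(2)[OF k] mult_left_mono[OF 1, of 3]]
          unfolding f_def abs_minus_commute[of _ 1] by (simp only: abs_of_nonneg zero_le_numeral)
      qed
      have "\<bar>LINT y|\<mu> (h n). f j y - 1\<bar> \<le> (LINT y|\<mu> (h n). \<bar>f j y - 1\<bar>)"
        by (rule integral_abs_bound)
      also have "\<dots> \<le> (LINT y|\<mu> (h n). 3 * (k j * L * min 1 ((norm y)\<^sup>2) + indicator {y. norm y > M} y))"
      proof (rule integral_mono')
        show "integrable (\<mu> (h n)) (\<lambda>y. 3 * (k j * L * min 1 ((norm y)\<^sup>2) + indicator {y. norm y > M} y))"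
          using int_w int_ind by (intro integrable_mult_right Bochner_Integration.integrable_add)
        show "0 \<le> 3 * (k j * L * min 1 ((norm y)\<^sup>2) + indicator {y. norm y > M} y)" for y :: "real ^ 'n"
          by (rule order_trans[OF abs_ge_zero pt])
      qed (rule pt)
      also have "\<dots> = 3 * (k j * L * (LINT y|\<mu> (h n). min 1 ((norm y)\<^sup>2)) + measure (\<mu> (h n)) {y. norm y > M})"
        using int_w int_ind by (simp add: space del: min_less_iff_conj)
      finally have "\<bar>LINT y|\<mu> (h n). f j y - 1\<bar> / h n \<le> \<dots> / h n"
        using h[of n] by (intro divide_right_mono) auto
      moreover have "a j n = (LINT y|\<mu> (h n). f j y - 1) / h n"
        by (simp add: a_def f_def bump_def)
      ultimately show ?thesis
        using h[of n] by (simp add: abs_divide add_divide_distrib)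
    qed
    have "\<bar>F j - c\<bar> \<le> 3 * (k j * L * K + \<epsilon>)" for j
    proof (rule tendsto_upperbound[OF tendsto_rabs[OF a_lim]])
      show "\<forall>\<^sub>F n in sequentially. \<bar>a j n\<bar> \<le> 3 * (k j * L * K + \<epsilon>)"
        using moment M(2)
      proof eventually_elim
        case (elim n)
        have "k j * L * (1 / h n * (LINT y|\<mu> (h n). min 1 ((norm y)\<^sup>2))) \<le> k j * L * K"
          using elim(1) k[of j] by (intro mult_left_mono) (auto simp: L_def)
        then have "k j * L * (1 / h n * (LINT y|\<mu> (h n). min 1 ((norm y)\<^sup>2)))
            + 1 / h n * measure (\<mu> (h n)) {y. norm y > M} \<le> k j * L * K + \<epsilon>"
          using less_imp_le[OF elim(2)] by (rule add_mono)
        then have "3 * (k j * L * (1 / h n * (LINT y|\<mu> (h n). min 1 ((norm y)\<^sup>2)))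
            + 1 / h n * measure (\<mu> (h n)) {y. norm y > M}) \<le> 3 * (k j * L * K + \<epsilon>)"
          by (rule mult_left_mono) simp
        with a_bound show ?case
          by (rule order_trans)
      qed
    qed simp
    moreover have "(\<lambda>j. \<bar>F j - c\<bar>) \<longlonglongrightarrow> \<bar>0 - c\<bar>"
      by (intro tendsto_intros F)
    moreover have "(\<lambda>j. 3 * (k j * L * K + \<epsilon>)) \<longlonglongrightarrow> 3 * (0 * L * K + \<epsilon>)"
      by (intro tendsto_intros k0)
    ultimately have "\<bar>0 - c\<bar> \<le> 3 * (0 * L * K + \<epsilon>)"
      by (intro LIMSEQ_le[of "\<lambda>j. \<bar>F j - c\<bar>"]) blast+
    then show ?thesis
      by simp
  qed
  show ?thesis
  proof (rule ccontr)
    assume "c \<noteq> 0"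
    \<comment> \<open>With this choice the bound reads \<open>c \<le> c / 2\<close>.\<close>
    then have "0 < c / 6"
      using \<open>c \<ge> 0\<close> by simp
    from c_le[OF this] \<open>0 < c / 6\<close> show False
      by linarith
  qed
qed

section \<open>Truncation and the compensated Taylor quotient\<close>

definition levy_weight :: "'a::real_normed_vector \<Rightarrow> real" where
  "levy_weight y = min 1 ((norm y)\<^sup>2)"

lemma levy_weight_bounds: "0 \<le> levy_weight y" "levy_weight y \<le> 1"
  by (simp_all add: levy_weight_def)

lemma levy_weight_eq_0_iff [simp]: "levy_weight y = 0 \<longleftrightarrow> y = 0"
  by (auto simp: levy_weight_def min_def)

lemma levy_weight_0 [simp]: "levy_weight 0 = 0"
  by simp

lemma levy_weight_pos_iff [simp]: "0 < levy_weight y \<longleftrightarrow> y \<noteq> 0"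
  using levy_weight_bounds(1)[of y] by (auto simp: less_le)

lemma levy_weight_ge_1: "1 \<le> norm y \<Longrightarrow> levy_weight y = 1"
  by (simp add: levy_weight_def one_le_power)

lemma continuous_levy_weight [continuous_intros]: "continuous_on S levy_weight"
  unfolding levy_weight_def by (intro continuous_intros)

lemma levy_weight_measurable [measurable]:
  "(levy_weight :: real ^ 'n \<Rightarrow> real) \<in> borel_measurable borel"
  by (intro borel_measurable_continuous_onI continuous_intros)

text \<open>A continuous substitute for the sharp cutoff at radius 1: the identity on the unit ball,
  0 beyond radius 2. Vague convergence can be applied only to continuous integrands;
  \<open>jump_drift\<close> later restores the sharp cutoff.\<close>

definition trunc :: "'a::real_normed_vector \<Rightarrow> 'a" where
  "trunc y = max 0 (min 1 (2 - norm y)) *\<^sub>R y"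

lemma continuous_trunc [continuous_intros]: "continuous_on S trunc"
  unfolding trunc_def by (intro continuous_intros)

lemma trunc_measurable [measurable]: "(trunc :: real ^ 'n \<Rightarrow> real ^ 'n) \<in> borel_measurable borel"
  by (intro borel_measurable_continuous_onI continuous_intros)

lemma trunc_component_measurable [measurable]:
  "(\<lambda>y :: real ^ 'n. trunc y $ i) \<in> borel_measurable borel"
  by (intro borel_measurable_continuous_onI continuous_intros)

lemma trunc_eq: "norm y \<le> 1 \<Longrightarrow> trunc y = y"
  by (simp add: trunc_def)

lemma trunc_zero [simp]: "trunc 0 = 0"
  by (simp add: trunc_def)

lemma trunc_eq_0: "2 \<le> norm y \<Longrightarrow> trunc y = 0"
  by (simp add: trunc_def max_def)

lemma norm_trunc_le_1: "norm (trunc y) \<le> 1"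
proof -
  consider "norm y \<le> 1" | "2 \<le> norm y" | "1 < norm y" "norm y < 2"
    by linarith
  then show ?thesis
  proof cases
    case 3
    \<comment> \<open>The left side equals \<open>1 - (norm y - 1) ^ 2\<close>.\<close>
    have "(2 - norm y) * norm y \<le> 1"
      using zero_le_power2[of "norm y - 1"] by (simp add: power2_eq_square algebra_simps)
    then show ?thesis
      using 3 by (simp add: trunc_def)
  qed (simp_all add: trunc_eq trunc_eq_0)
qed

lemma norm_trunc_le: "norm (trunc y) \<le> norm y"
proof -
  have "\<bar>max 0 (min 1 (2 - norm y))\<bar> * norm y \<le> 1 * norm y"
    by (intro mult_right_mono) auto
  then show ?thesis
    by (simp add: trunc_def)
qed

lemma norm_trunc_square_le: "(norm (trunc y))\<^sup>2 \<le> levy_weight y"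
  unfolding levy_weight_def
  using power_mono[OF norm_trunc_le_1, of y 2] power_mono[OF norm_trunc_le, of y 2] by simp

lemma trunc_component_mult_le: "\<bar>trunc y $ i * trunc y $ j\<bar> \<le> levy_weight (y :: real ^ 'n)"
proof -
  have "\<bar>trunc y $ i\<bar> * \<bar>trunc y $ j\<bar> \<le> norm (trunc y) * norm (trunc y)"
    by (intro mult_mono component_le_norm_cart) auto
  also have "\<dots> \<le> levy_weight y"
    using norm_trunc_square_le[of y] by (simp add: power2_eq_square)
  finally show ?thesis
    by (simp add: abs_mult)
qed

text \<open>The sharp cutoff that occurs in the moment condition and in
  \<open>levy_operator\<close>.\<close>

definition unit_ball_part :: "'a::real_normed_vector \<Rightarrow> 'a" where
  "unit_ball_part y = indicator {y. norm y \<le> 1} y *\<^sub>R y"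

lemma unit_ball_part_measurable [measurable]:
  "(unit_ball_part :: real ^ 'n \<Rightarrow> real ^ 'n) \<in> borel_measurable borel"
  unfolding unit_ball_part_def by measurable

lemma norm_unit_ball_part_le_1: "norm (unit_ball_part y) \<le> 1"
  by (auto simp: unit_ball_part_def indicator_def)

text \<open>The two cutoffs agree on the unit ball, and outside it the weight is 1. Exchanging them
  therefore costs no more than the truncated second moment.\<close>

lemma norm_unit_ball_part_diff_trunc: "norm (unit_ball_part y - trunc y) \<le> levy_weight y"
proof (cases "norm y \<le> 1")
  case True
  then show ?thesis
    by (simp add: unit_ball_part_def trunc_eq levy_weight_bounds)
next
  case False
  then show ?thesis
    using norm_trunc_le_1[of y] by (simp add: unit_ball_part_def levy_weight_ge_1)
qed

lemma quadratic_form_eq_sum: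
  fixes H :: "real ^ 'n ^ 'n"
  shows "v \<bullet> (H *v v) = (\<Sum>i\<in>UNIV. \<Sum>j\<in>UNIV. H $ i $ j * (v $ i * v $ j))"
  by (simp add: inner_vec_def matrix_vector_mult_def sum_distrib_left mult_ac)

lemma inner_square_eq_sum:
  fixes u v :: "real ^ 'n"
  shows "(u \<bullet> v)\<^sup>2 = (\<Sum>i\<in>UNIV. \<Sum>j\<in>UNIV. (u $ i * u $ j) * (v $ i * v $ j))"
  by (simp add: inner_vec_def power2_eq_square sum_product mult_ac)

text \<open>The trace pairs \<open>\<sigma> $ i $ j\<close> with \<open>H $ j $ i\<close>. Symmetry
  of \<open>\<sigma>\<close> aligns the indices, which gives the same pairing as in
  \<open>quadratic_form_eq_sum\<close>.\<close>

lemma trace_mult_symmetric: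
  fixes \<sigma> H :: "real ^ 'n ^ 'n"
  assumes "transpose \<sigma> = \<sigma>"
  shows "trace (\<sigma> ** H) = (\<Sum>i\<in>UNIV. \<Sum>j\<in>UNIV. H $ i $ j * \<sigma> $ i $ j)"
proof -
  have "\<sigma> $ i $ j = \<sigma> $ j $ i" for i j
    using arg_cong[OF assms, of "\<lambda>A. A $ j $ i"] by (simp add: transpose_def)
  then have "trace (\<sigma> ** H) = (\<Sum>i\<in>UNIV. \<Sum>j\<in>UNIV. H $ j $ i * \<sigma> $ j $ i)"
    by (simp add: trace_def matrix_matrix_mult_def mult.commute)
  then show ?thesis
    by (subst sum.swap)
qed

text \<open>The added constant \<open>f x\<close> compensates \<open>f (x + y) - f x = - f x\<close> for large \<open>y\<close>, so that the
  quotient has compact support. Since \<open>0 / 0 = 0\<close>, its value at \<open>y = 0\<close> is \<open>f x\<close>, the continuous one.\<close>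

definition taylor_quotient :: "(real ^ 'n \<Rightarrow> real) \<Rightarrow> real ^ 'n \<Rightarrow> real ^ 'n \<Rightarrow> real" where
  "taylor_quotient f x y = (f (x + y) - f x - gradient f x \<bullet> trunc y
      - 1/2 * (trunc y \<bullet> (hessian f x *v trunc y))) / levy_weight y + f x"

text \<open>Away from the origin the denominator is nonzero. Near it \<open>trunc\<close> is the
  identity and the weight is |y|^2, so the quotient is the Taylor remainder ratio plus
  \<open>f x\<close>, which tends to \<open>f x\<close>.\<close>

lemma continuous_taylor_quotient:
  assumes "f \<in> Cc2"
  shows "continuous_on UNIV (taylor_quotient f x)"
  unfolding continuous_on_eq_continuous_at[OF open_UNIV]
proof
  have cont_f: "continuous_on UNIV f"
    using assms by (rule Cc2_continuous)
  fix y
  show "isCont (taylor_quotient f x) y"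
  proof (cases "y = 0")
    case False
    have "continuous_on (- {0}) (\<lambda>y. f (x + y))"
      by (rule continuous_on_compose2[OF cont_f]) (auto intro!: continuous_intros)
    then have "continuous_on (- {0}) (taylor_quotient f x)"
      unfolding taylor_quotient_def quadratic_form_eq_sum by (intro continuous_intros) auto
    then show ?thesis
      using False continuous_on_eq_continuous_at[of "- {0}"] by blast
  next
    case True
    have "twice_cont_diff f"
      using assms by (simp add: Cc2_def)
    then have lim: "((\<lambda>y. (f (x + y) - f x - gradient f x \<bullet> y - 1/2 * (y \<bullet> (hessian f x *v y))) / (norm y)\<^sup>2 + f x) \<longlongrightarrow> 0 + f x) (at 0)"
      by (intro tendsto_intros second_order_taylor)
    have "taylor_quotient f x y = (f (x + y) - f x - gradient f x \<bullet> y - 1/2 * (y \<bullet> (hessian f x *v y))) / (norm y)\<^sup>2 + f x"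
      if "norm y < 1" for y
    proof -
      have "(norm y)\<^sup>2 \<le> 1"
        using that by (simp add: power_le_one)
      then show ?thesis
        using that by (simp add: taylor_quotient_def trunc_eq levy_weight_def)
    qed
    then have "\<forall>\<^sub>F y in at 0. taylor_quotient f x y =
        (f (x + y) - f x - gradient f x \<bullet> y - 1/2 * (y \<bullet> (hessian f x *v y))) / (norm y)\<^sup>2 + f x"
      unfolding eventually_at by (intro exI[of _ 1]) simp
    then have "(taylor_quotient f x \<longlongrightarrow> 0 + f x) (at 0)"
      using lim by (subst tendsto_cong)
    moreover have "taylor_quotient f x 0 = f x"
      by (simp add: taylor_quotient_def)
    ultimately show ?thesis
      using True by (simp add: isCont_def)
  qed
qed

lemma taylor_quotient_vanishes:
  assumes "f \<in> Cc2"
  obtains R where "\<And>y. R \<le> norm y \<Longrightarrow> taylor_quotient f x y = 0"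
proof -
  have "bounded {z. f z \<noteq> 0}"
    using assms bounded_subset[OF compact_imp_bounded closure_subset] by (simp add: Cc2_def)
  then obtain a where a: "\<And>z. f z \<noteq> 0 \<Longrightarrow> norm z \<le> a"
    unfolding bounded_iff by blast
  \<comment> \<open>Radius 2 annihilates \<open>trunc\<close>; radius \<open>a + norm x + 1\<close>
    moves \<open>x + y\<close> out of the support of \<open>f\<close>.\<close>
  have "taylor_quotient f x y = 0" if "max 2 (a + norm x + 1) \<le> norm y" for y
  proof -
    have "norm y \<le> norm (x + y) + norm x"
      using norm_triangle_ineq4[of "x + y" x] by simp
    then have "f (x + y) = 0"
      using a[of "x + y"] that by auto
    then show ?thesis
      using that by (simp add: taylor_quotient_def trunc_eq_0 levy_weight_ge_1)
  qed
  then show thesis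
    by (rule that)
qed

section \<open>The limiting triplet\<close>

text \<open>Here \<open>levy_weight 0 = 0\<close> and \<open>1 / 0 = 0\<close>: an atom of \<open>R\<close> at the origin is discarded.\<close>

definition jump_measure :: "(real ^ 'n) measure \<Rightarrow> (real ^ 'n) measure" where
  "jump_measure R = density R (\<lambda>y. ennreal (1 / levy_weight y))"

text \<open>The second moment of \<open>trunc\<close> under \<open>jump_measure R\<close>, written
  as an integral of bounded functions against the finite measure \<open>R\<close>.\<close>

definition jump_covariance :: "(real ^ 'n) measure \<Rightarrow> real ^ 'n ^ 'n" where
  "jump_covariance R = (\<chi> i j. LINT y|R. trunc y $ i * trunc y $ j / levy_weight y)"

text \<open>The correction to the drift when the continuous cutoff is replaced by the sharp one
  under \<open>jump_measure R\<close>.\<close>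

definition jump_drift :: "(real ^ 'n) measure \<Rightarrow> real ^ 'n" where
  "jump_drift R = (LINT y|R. (1 / levy_weight y) *\<^sub>R (unit_ball_part y - trunc y))"

context
  fixes R :: "(real ^ 'n) measure"
  assumes fin: "finite_measure R" and sets_R[measurable_cong]: "sets R = sets borel"
begin

interpretation finite_measure R
  by (rule fin)

lemma space_R: "space R = UNIV"
  using sets_eq_imp_space_eq[OF sets_R] by simp

lemma integral_jump_measure:
  fixes F :: "real ^ 'n \<Rightarrow> real"
  assumes [measurable]: "F \<in> borel_measurable borel"
  shows "integral\<^sup>L (jump_measure R) F = (LINT y|R. F y / levy_weight y)"
  unfolding jump_measure_def
  by (subst integral_density) (auto simp: levy_weight_bounds)

text \<open>Off the origin the weight cancels the density, so the integral is at most the total mass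
  of \<open>R\<close>; at the origin the density is 0.\<close>

lemma levy_measure_jump_measure: "levy_measure (jump_measure R)"
  unfolding levy_measure_def
proof (intro conjI)
  show "sets (jump_measure R) = sets borel"
    by (simp add: jump_measure_def sets_R)
  have "emeasure (jump_measure R) {0} = (\<integral>\<^sup>+ y. ennreal (1 / levy_weight y) * indicator {0} y \<partial>R)"
    unfolding jump_measure_def by (intro emeasure_density) simp_all
  also have "\<dots> = (\<integral>\<^sup>+ y. 0 \<partial>R)"
    by (intro nn_integral_cong) (auto simp: indicator_def)
  finally show "emeasure (jump_measure R) {0} = 0"
    by simp
  have "(\<integral>\<^sup>+ y. ennreal (min 1 ((norm y)\<^sup>2)) \<partial>jump_measure R)
      = (\<integral>\<^sup>+ y. ennreal (1 / levy_weight y) * ennreal (levy_weight y) \<partial>R)"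
    unfolding jump_measure_def levy_weight_def[symmetric] by (intro nn_integral_density) simp_all
  also have "\<dots> \<le> (\<integral>\<^sup>+ y. 1 \<partial>R)"
  proof (intro nn_integral_mono)
    fix y :: "real ^ 'n"
    have "ennreal (1 / levy_weight y) * ennreal (levy_weight y) = ennreal (1 / levy_weight y * levy_weight y)"
      by (intro ennreal_mult[symmetric]) (simp_all add: levy_weight_bounds)
    also have "\<dots> \<le> 1"
      by (cases "y = 0") auto
    finally show "ennreal (1 / levy_weight y) * ennreal (levy_weight y) \<le> 1" .
  qed
  also have "\<dots> < \<infinity>"
    by (simp add: emeasure_eq_measure)
  finally show "(\<integral>\<^sup>+ y. ennreal (min 1 ((norm y)\<^sup>2)) \<partial>jump_measure R) < \<infinity>" .
qed

lemma integrable_trunc_trunc: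
  "integrable R (\<lambda>y. trunc y $ i * trunc y $ j / levy_weight y)"
proof (rule integrable_const_bound[where B = 1])
  have "norm (trunc y $ i * trunc y $ j / levy_weight y) \<le> 1" for y :: "real ^ 'n"
    using trunc_component_mult_le[of y i j] levy_weight_bounds(1)[of y]
    by (cases "y = 0") (auto simp: abs_divide divide_le_eq_1)
  then show "AE y in R. norm (trunc y $ i * trunc y $ j / levy_weight y) \<le> 1"
    by simp
qed measurable

lemma integrable_drift_integrand:
  "integrable R (\<lambda>y. (1 / levy_weight y) *\<^sub>R (unit_ball_part y - trunc y))"
proof (rule integrable_const_bound[where B = 1])
  have "norm ((1 / levy_weight y) *\<^sub>R (unit_ball_part y - trunc y)) \<le> 1" for y :: "real ^ 'n"
    using norm_unit_ball_part_diff_trunc[of y] levy_weight_bounds(1)[of y]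
    by (cases "y = 0") (auto simp: divide_le_eq_1)
  then show "AE y in R. norm ((1 / levy_weight y) *\<^sub>R (unit_ball_part y - trunc y)) \<le> 1"
    by simp
qed measurable

text \<open>Brings the limit operator into the shape of \<open>difference_quotient_eq\<close>, with
  \<open>b\<close>, \<open>A\<close> and \<open>m\<close> in the roles of limiting mean, second
  moment and mass. The summand \<open>f x\<close> in \<open>taylor_quotient\<close> contributes
  \<open>f x * measure R UNIV\<close>; subtracting \<open>m - measure R UNIV\<close> times
  \<open>f x\<close> turns this into the mass term.\<close>

lemma levy_operator_eq:
  assumes f: "f \<in> Cc2" and sym: "transpose A = A"
  shows "levy_operator (b + jump_drift R) (A - jump_covariance R) (jump_measure R) f x
        - (m - measure R UNIV) * f x
    = gradient f x \<bullet> b + 1/2 * (\<Sum>i\<in>UNIV. \<Sum>j\<in>UNIV. hessian f x $ i $ j * A $ i $ j)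
        - f x * m + integral\<^sup>L R (taylor_quotient f x)"
proof -
  define g where "g = gradient f x"
  define H where "H = hessian f x"
  define D where "D = (\<lambda>y :: real ^ 'n. (1 / levy_weight y) *\<^sub>R (unit_ball_part y - trunc y))"
  define C where "C = (\<lambda>i j (y :: real ^ 'n). trunc y $ i * trunc y $ j / levy_weight y)"
  have f_meas[measurable]: "f \<in> borel_measurable borel"
    using Cc2_continuous[OF f] by (rule borel_measurable_continuous_onI)
  have tq_meas[measurable]: "taylor_quotient f x \<in> borel_measurable borel"
    using continuous_taylor_quotient[OF f] by (rule borel_measurable_continuous_onI)
  obtain S where "\<And>y. S \<le> norm y \<Longrightarrow> taylor_quotient f x y = 0"
    using taylor_quotient_vanishes[OF f] by blast
  then obtain B where "\<And>y. norm (taylor_quotient f x y) \<le> B"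
    using bounded_if_vanishes_outside_cball[OF continuous_taylor_quotient[OF f]] by blast
  then have int_tq: "integrable R (taylor_quotient f x)"
    by (intro integrable_const_bound[where B = B]) simp_all
  have int_D: "integrable R D"
    unfolding D_def by (rule integrable_drift_integrand)
  have int_C: "integrable R (C i j)" for i j
    unfolding C_def by (rule integrable_trunc_trunc)
  have "transpose (A - jump_covariance R) = A - jump_covariance R"
    using sym by (simp add: transpose_def jump_covariance_def vec_eq_iff mult.commute)
  then have tr: "trace ((A - jump_covariance R) ** H)
      = (\<Sum>i\<in>UNIV. \<Sum>j\<in>UNIV. H $ i $ j * A $ i $ j) - (\<Sum>i\<in>UNIV. \<Sum>j\<in>UNIV. H $ i $ j * integral\<^sup>L R (C i j))"
    by (simp add: trace_mult_symmetric jump_covariance_def C_def right_diff_distrib sum_subtractf)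
  have "(LINT y:UNIV - {0}|jump_measure R. f (x + y) - f x - (g \<bullet> y) * indicator {y. norm y \<le> 1} y)
      = (LINT y|R. (indicator (UNIV - {0}) y *\<^sub>R (f (x + y) - f x - (g \<bullet> y) * indicator {y. norm y \<le> 1} y)) / levy_weight y)"
    unfolding set_lebesgue_integral_def by (rule integral_jump_measure) measurable
  \<comment> \<open>The identity holds pointwise, including the origin: there the left side is 0,
    and on the right \<open>taylor_quotient f x 0 = f x\<close> cancels against
    \<open>- f x\<close>.\<close>
  also have "\<dots> = (LINT y|R. taylor_quotient f x y - f x - g \<bullet> D y + 1/2 * (\<Sum>i\<in>UNIV. \<Sum>j\<in>UNIV. H $ i $ j * C i j y))"
  proof (rule Bochner_Integration.integral_cong[OF refl])
    fix y :: "real ^ 'n"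
    have "(\<Sum>i\<in>UNIV. \<Sum>j\<in>UNIV. H $ i $ j * C i j y) = (trunc y \<bullet> (H *v trunc y)) / levy_weight y"
      by (simp add: C_def quadratic_form_eq_sum sum_divide_distrib)
    moreover have "g \<bullet> D y = ((g \<bullet> y) * indicator {y. norm y \<le> 1} y - g \<bullet> trunc y) / levy_weight y"
      by (simp add: D_def unit_ball_part_def inner_diff_right mult.commute)
    ultimately show "(indicator (UNIV - {0}) y *\<^sub>R (f (x + y) - f x - (g \<bullet> y) * indicator {y. norm y \<le> 1} y)) / levy_weight y
        = taylor_quotient f x y - f x - g \<bullet> D y + 1/2 * (\<Sum>i\<in>UNIV. \<Sum>j\<in>UNIV. H $ i $ j * C i j y)"
      by (cases "y = 0") (simp_all add: taylor_quotient_def g_def H_def diff_divide_distrib)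
  qed
  also have "\<dots> = integral\<^sup>L R (taylor_quotient f x) - f x * measure R UNIV - g \<bullet> jump_drift R
      + 1/2 * (\<Sum>i\<in>UNIV. \<Sum>j\<in>UNIV. H $ i $ j * integral\<^sup>L R (C i j))"
  proof -
    have "jump_drift R = integral\<^sup>L R D"
      by (simp add: jump_drift_def D_def)
    then have "g \<bullet> jump_drift R = (LINT y|R. g \<bullet> D y)"
      using int_D by simp
    then show ?thesis
      using int_tq int_D int_C by (simp add: Bochner_Integration.integral_sum space_R mult.commute)
  qed
  finally show ?thesis
    unfolding levy_operator_def g_def[symmetric] H_def[symmetric] tr
    by (simp add: inner_add_left inner_commute[of g] algebra_simps)
qed

end

section \<open>Scaled moments and weighted measures at a fixed time step\<close>

lemma norm_matrix_le_sum:
  fixes A :: "real ^ 'n ^ 'm"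
  shows "norm A \<le> (\<Sum>i\<in>UNIV. \<Sum>j\<in>UNIV. \<bar>A $ i $ j\<bar>)"
proof -
  have "norm A \<le> (\<Sum>i\<in>UNIV. norm (A $ i))"
    unfolding norm_vec_def by (intro L2_set_le_sum) simp
  also have "\<dots> \<le> (\<Sum>i\<in>UNIV. \<Sum>j\<in>UNIV. \<bar>A $ i $ j\<bar>)"
    by (intro sum_mono norm_le_l1_cart)
  finally show ?thesis .
qed

definition scaled_second_moment :: "real \<Rightarrow> (real ^ 'n) measure \<Rightarrow> real ^ 'n ^ 'n" where
  "scaled_second_moment h M = (\<chi> i j. (LINT y|M. trunc y $ i * trunc y $ j) / h)"

definition weighted_measure :: "real \<Rightarrow> (real ^ 'n) measure \<Rightarrow> (real ^ 'n) measure" where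
  "weighted_measure h M = density M (\<lambda>y. ennreal (levy_weight y / h))"

context
  fixes M :: "(real ^ 'n) measure" and h :: real
  assumes prob: "prob_space M" and sets_M[measurable_cong]: "sets M = sets borel" and h: "h > 0"
begin

interpretation prob_space M
  by (rule prob)

lemma space_M: "space M = UNIV"
  using sets_eq_imp_space_eq[OF sets_M] by simp

lemma integrable_bounded_borel:
  fixes f :: "real ^ 'n \<Rightarrow> 'b::{banach, second_countable_topology}"
  assumes "f \<in> borel_measurable borel" "\<And>y. norm (f y) \<le> B"
  shows "integrable M f"
  using assms by (intro integrable_const_bound[where B = B]) simp_all

lemma integrable_levy_weight: "integrable M levy_weight"
  by (rule integrable_bounded_borel[where B = 1]) (auto simp: levy_weight_bounds)

lemma integrable_trunc: "integrable M trunc"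
  by (rule integrable_bounded_borel[where B = 1]) (auto simp: norm_trunc_le_1)

lemma integrable_trunc_component_mult: "integrable M (\<lambda>y. trunc y $ i * trunc y $ j)"
  by (rule integrable_bounded_borel[where B = 1])
     (use order_trans[OF trunc_component_mult_le levy_weight_bounds(2)] in auto)

lemma integral_weighted_measure:
  fixes F :: "real ^ 'n \<Rightarrow> real"
  assumes [measurable]: "F \<in> borel_measurable borel"
  shows "integral\<^sup>L (weighted_measure h M) F = (LINT y|M. levy_weight y * F y) / h"
proof -
  have "integral\<^sup>L (weighted_measure h M) F = (LINT y|M. (levy_weight y / h) *\<^sub>R F y)"
    unfolding weighted_measure_def using h by (intro integral_density) (auto simp: levy_weight_bounds)
  then show ?thesis
    by simp
qed

lemma sets_weighted_measure: "sets (weighted_measure h M) = sets borel"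
  by (simp add: weighted_measure_def sets_M)

lemma emeasure_weighted_measure: "emeasure (weighted_measure h M) UNIV = ennreal ((LINT y|M. levy_weight y) / h)"
proof -
  have "emeasure (weighted_measure h M) UNIV = (\<integral>\<^sup>+ y. ennreal (levy_weight y / h) \<partial>M)"
    unfolding weighted_measure_def by (subst emeasure_density) (auto simp: sets_M)
  also have "\<dots> = ennreal (LINT y|M. levy_weight y / h)"
    using integrable_levy_weight h by (intro nn_integral_eq_integral) (auto simp: levy_weight_bounds)
  finally show ?thesis
    by simp
qed

lemma finite_measure_weighted_measure: "finite_measure (weighted_measure h M)"
proof
  have "space (weighted_measure h M) = UNIV"
    by (simp add: weighted_measure_def space_M)
  then show "emeasure (weighted_measure h M) (space (weighted_measure h M)) \<noteq> \<infinity>"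
    by (simp add: emeasure_weighted_measure)
qed

lemma measure_weighted_measure: "measure (weighted_measure h M) UNIV = (LINT y|M. levy_weight y) / h"
  using h by (simp add: measure_def emeasure_weighted_measure levy_weight_bounds)

lemma scaled_second_moment_quadratic_form:
  "u \<bullet> (scaled_second_moment h M *v u) = (LINT y|M. (u \<bullet> trunc y)\<^sup>2) / h"
proof -
  have "(LINT y|M. (u \<bullet> trunc y)\<^sup>2) = (\<Sum>i\<in>UNIV. \<Sum>j\<in>UNIV. (u $ i * u $ j) * (LINT y|M. trunc y $ i * trunc y $ j))"
    unfolding inner_square_eq_sum
    using integrable_trunc_component_mult by (simp add: Bochner_Integration.integral_sum)
  then show ?thesis
    unfolding quadratic_form_eq_sum by (simp add: scaled_second_moment_def sum_divide_distrib mult_ac)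
qed

text \<open>The assumption controls the mean with sharp cutoff; passing to \<open>trunc\<close> adds
  at most the integral of the weight, which the assumption controls as well.\<close>

lemma norm_scaled_mean_le:
  assumes "1 / h * ((LINT y|M. levy_weight y) + norm (LINT y|M. unit_ball_part y)) \<le> K"
  shows "norm ((1 / h) *\<^sub>R (LINT y|M. trunc y)) \<le> K"
proof -
  have int_I: "integrable M unit_ball_part"
    by (rule integrable_bounded_borel[where B = 1]) (auto simp: norm_unit_ball_part_le_1)
  have "norm (LINT y|M. unit_ball_part y - trunc y) \<le> (LINT y|M. norm (unit_ball_part y - trunc y))"
    by (rule integral_norm_bound)
  also have "\<dots> \<le> (LINT y|M. levy_weight y)"
    using int_I integrable_trunc integrable_levy_weight norm_unit_ball_part_diff_trunc
    by (intro integral_mono) auto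
  finally have diff: "norm ((LINT y|M. unit_ball_part y) - (LINT y|M. trunc y)) \<le> (LINT y|M. levy_weight y)"
    using int_I integrable_trunc by simp
  have "norm (LINT y|M. trunc y) \<le> (LINT y|M. levy_weight y) + norm (LINT y|M. unit_ball_part y)"
    using norm_triangle_sub[of "LINT y|M. trunc y" "LINT y|M. unit_ball_part y"] diff
    by (simp add: norm_minus_commute)
  then have "1 / h * norm (LINT y|M. trunc y) \<le> 1 / h * ((LINT y|M. levy_weight y) + norm (LINT y|M. unit_ball_part y))"
    using h by (intro mult_left_mono) auto
  then show ?thesis
    using assms h by simp
qed

lemma norm_scaled_second_moment_le:
  assumes "(LINT y|M. levy_weight y) / h \<le> K"
  shows "norm (scaled_second_moment h M) \<le> (\<Sum>i\<in>(UNIV :: 'n set). \<Sum>j\<in>(UNIV :: 'n set). K)"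
proof -
  have "\<bar>scaled_second_moment h M $ i $ j\<bar> \<le> K" for i j
  proof -
    have "\<bar>LINT y|M. trunc y $ i * trunc y $ j\<bar> \<le> (LINT y|M. \<bar>trunc y $ i * trunc y $ j\<bar>)"
      by (rule integral_abs_bound)
    also have "\<dots> \<le> (LINT y|M. levy_weight y)"
      using integrable_trunc_component_mult integrable_levy_weight trunc_component_mult_le
      by (intro integral_mono) auto
    finally have "\<bar>LINT y|M. trunc y $ i * trunc y $ j\<bar> / h \<le> (LINT y|M. levy_weight y) / h"
      using h by (intro divide_right_mono) auto
    then show ?thesis
      using assms h by (simp add: scaled_second_moment_def abs_divide)
  qed
  then show ?thesis
    by (intro order_trans[OF norm_matrix_le_sum] sum_mono)
qed

text \<open>An exact Taylor identity, solved from the definition of \<open>taylor_quotient\<close>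
  and integrated. Each of its four summands depends on the measure only through a quantity that
  converges along a subsequence.\<close>

lemma difference_quotient_eq:
  assumes f: "f \<in> Cc2"
  shows "(LINT y|M. (f (x + y) - f x) / h)
    = gradient f x \<bullet> ((1 / h) *\<^sub>R (LINT y|M. trunc y))
      + 1/2 * (\<Sum>i\<in>UNIV. \<Sum>j\<in>UNIV. hessian f x $ i $ j * scaled_second_moment h M $ i $ j)
      - f x * measure (weighted_measure h M) UNIV + integral\<^sup>L (weighted_measure h M) (taylor_quotient f x)"
proof -
  define g where "g = gradient f x"
  define H where "H = hessian f x"
  have tq_meas[measurable]: "taylor_quotient f x \<in> borel_measurable borel"
    using continuous_taylor_quotient[OF f] by (rule borel_measurable_continuous_onI)
  obtain S where "\<And>y. S \<le> norm y \<Longrightarrow> taylor_quotient f x y = 0"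
    using taylor_quotient_vanishes[OF f] by blast
  then obtain B where B: "\<And>y. norm (taylor_quotient f x y) \<le> B"
    using bounded_if_vanishes_outside_cball[OF continuous_taylor_quotient[OF f]] by blast
  have int_tq: "integrable M (\<lambda>y. levy_weight y * taylor_quotient f x y)"
  proof (rule integrable_bounded_borel[where B = "1 * B"])
    show "norm (levy_weight y * taylor_quotient f x y) \<le> 1 * B" for y
      unfolding norm_mult using B by (intro mult_mono) (auto simp: levy_weight_bounds)
  qed measurable
  have "f (x + y) - f x = g \<bullet> trunc y + 1/2 * (\<Sum>i\<in>UNIV. \<Sum>j\<in>UNIV. H $ i $ j * (trunc y $ i * trunc y $ j))
      - f x * levy_weight y + levy_weight y * taylor_quotient f x y" for y
    unfolding quadratic_form_eq_sum[symmetric]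
    by (cases "y = 0") (simp_all add: taylor_quotient_def g_def H_def field_simps)
  then have "(LINT y|M. f (x + y) - f x) = g \<bullet> (LINT y|M. trunc y)
      + 1/2 * (\<Sum>i\<in>UNIV. \<Sum>j\<in>UNIV. H $ i $ j * (LINT y|M. trunc y $ i * trunc y $ j))
      - f x * (LINT y|M. levy_weight y) + (LINT y|M. levy_weight y * taylor_quotient f x y)"
    using int_tq integrable_trunc integrable_trunc_component_mult integrable_levy_weight
    by (simp add: Bochner_Integration.integral_sum)
  then show ?thesis
    unfolding measure_weighted_measure integral_weighted_measure[OF tq_meas] g_def[symmetric] H_def[symmetric]
      integral_divide_zero
    by (simp add: scaled_second_moment_def add_divide_distrib diff_divide_distrib sum_divide_distrib mult.commute[of 2 h])
qed

text \<open>The ratio of \<open>levy_weight y\<close> to \<open>max (levy_weight y) \<delta>\<close>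
  is at most 1. The regularised integrand is continuous with compact support, so the inequality
  passes to the vague limit.\<close>

lemma weighted_measure_quadratic_form_le:
  assumes "\<delta> > 0"
  shows "(LINT y|weighted_measure h M. (u \<bullet> trunc y)\<^sup>2 / max (levy_weight y) \<delta>)
    \<le> u \<bullet> (scaled_second_moment h M *v u)"
proof -
  have int: "integrable M (\<lambda>y. (u \<bullet> trunc y)\<^sup>2)"
    unfolding inner_square_eq_sum using integrable_trunc_component_mult by simp
  have "levy_weight y * ((u \<bullet> trunc y)\<^sup>2 / max (levy_weight y) \<delta>) \<le> (u \<bullet> trunc y)\<^sup>2" for y
  proof -
    have "levy_weight y * (u \<bullet> trunc y)\<^sup>2 \<le> max (levy_weight y) \<delta> * (u \<bullet> trunc y)\<^sup>2"
      by (intro mult_right_mono) auto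
    then show ?thesis
      using assms by (simp add: pos_divide_le_eq less_max_iff_disj mult.commute)
  qed
  then have "(LINT y|M. levy_weight y * ((u \<bullet> trunc y)\<^sup>2 / max (levy_weight y) \<delta>)) \<le> (LINT y|M. (u \<bullet> trunc y)\<^sup>2)"
    using int by (intro integral_mono') auto
  then show ?thesis
    unfolding scaled_second_moment_quadratic_form
    using h by (subst integral_weighted_measure) (auto intro: divide_right_mono)
qed

end

text \<open>The quadratic form of the jump part is discontinuous at the origin as a function of \<open>y\<close>, so
  it is approached from below by the continuous functions with \<open>levy_weight y\<close> replaced by
  \<open>max (levy_weight y) \<delta>\<close>.\<close>

lemma jump_covariance_quadratic_form_le:
  fixes R :: "(real ^ 'n) measure"
  assumes fin: "finite_measure R" and sets_R[measurable_cong]: "sets R = sets borel"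
    and le: "\<And>\<delta>. \<delta> > 0 \<Longrightarrow> (LINT y|R. (u \<bullet> trunc y)\<^sup>2 / max (levy_weight y) \<delta>) \<le> a"
  shows "u \<bullet> (jump_covariance R *v u) \<le> a"
proof -
  interpret finite_measure R
    by (rule fin)
  define \<delta> where "\<delta> k = 1 / real (Suc k)" for k
  have \<delta>: "\<delta> k > 0" for k
    by (simp add: \<delta>_def)
  have \<delta>_lim: "\<delta> \<longlonglongrightarrow> 0"
    unfolding \<delta>_def using LIMSEQ_inverse_real_of_nat by (simp add: inverse_eq_divide)
  have "u \<bullet> (jump_covariance R *v u) = (LINT y|R. (u \<bullet> trunc y)\<^sup>2 / levy_weight y)"
    unfolding inner_square_eq_sum sum_divide_distrib quadratic_form_eq_sum
    using integrable_trunc_trunc[OF fin sets_R]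
    by (simp add: jump_covariance_def Bochner_Integration.integral_sum mult_ac flip: times_divide_eq_right)
  moreover have "(\<lambda>k. LINT y|R. (u \<bullet> trunc y)\<^sup>2 / max (levy_weight y) (\<delta> k))
      \<longlonglongrightarrow> (LINT y|R. (u \<bullet> trunc y)\<^sup>2 / levy_weight y)"
  \<comment> \<open>The majorant comes from Cauchy-Schwarz and \<open>norm_trunc_square_le\<close>;
    it is integrable as \<open>R\<close> is finite.\<close>
  proof (rule integral_dominated_convergence[where w = "\<lambda>_. (norm u)\<^sup>2"])
    have "(\<lambda>k. (u \<bullet> trunc y)\<^sup>2 / max (levy_weight y) (\<delta> k)) \<longlonglongrightarrow> (u \<bullet> trunc y)\<^sup>2 / levy_weight y" for y
    proof (cases "y = 0")
      case False
      have "(\<lambda>k. (u \<bullet> trunc y)\<^sup>2 / max (levy_weight y) (\<delta> k)) \<longlonglongrightarrow> (u \<bullet> trunc y)\<^sup>2 / max (levy_weight y) 0"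
        using False levy_weight_bounds(1)[of y] by (intro tendsto_intros \<delta>_lim) (simp add: max_def)
      then show ?thesis
        by (simp add: max_absorb1 levy_weight_bounds)
    qed simp
    then show "AE y in R. (\<lambda>k. (u \<bullet> trunc y)\<^sup>2 / max (levy_weight y) (\<delta> k)) \<longlonglongrightarrow> (u \<bullet> trunc y)\<^sup>2 / levy_weight y"
      by simp
    have "norm ((u \<bullet> trunc y)\<^sup>2 / max (levy_weight y) (\<delta> k)) \<le> (norm u)\<^sup>2" for y k
    proof -
      have pos: "0 < max (levy_weight y) (\<delta> k)"
        using \<delta>[of k] by (simp add: less_max_iff_disj)
      have "(u \<bullet> trunc y)\<^sup>2 \<le> (norm u * norm (trunc y))\<^sup>2"
        by (intro abs_le_square_iff[THEN iffD1]) (simp add: Cauchy_Schwarz_ineq2)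
      also have "\<dots> \<le> (norm u)\<^sup>2 * levy_weight y"
        unfolding power_mult_distrib by (intro mult_left_mono norm_trunc_square_le) simp
      also have "\<dots> \<le> (norm u)\<^sup>2 * max (levy_weight y) (\<delta> k)"
        by (intro mult_left_mono) auto
      finally show ?thesis
        using pos by (simp add: pos_divide_le_eq)
    qed
    then show "AE y in R. norm ((u \<bullet> trunc y)\<^sup>2 / max (levy_weight y) (\<delta> k)) \<le> (norm u)\<^sup>2" for k
      by simp
  qed simp_all
  ultimately show ?thesis
    using le[OF \<delta>] by (metis (no_types, lifting) LIMSEQ_le_const2)
qed

section \<open>Extraction of a convergent subsequence and its triplet\<close>

lemma tendsto_matrix_quadratic_form:
  fixes A :: "nat \<Rightarrow> real ^ 'n ^ 'n"
  assumes "A \<longlonglongrightarrow> L"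
  shows "(\<lambda>n. u \<bullet> (A n *v u)) \<longlonglongrightarrow> u \<bullet> (L *v u)"
  unfolding quadratic_form_eq_sum by (intro tendsto_intros assms)

lemma moments_bounded_imp_generator_limit:
  fixes \<mu> :: "real \<Rightarrow> (real ^ 'n) measure"
  assumes h: "\<And>n. h n > 0"
    and prob: "\<And>n. prob_space (\<mu> (h n))" and sets: "\<And>n. sets (\<mu> (h n)) = sets borel"
    and bound: "\<And>n. 1 / h n * ((LINT y|\<mu> (h n). min 1 ((norm y)\<^sup>2))
      + norm (LINT y:{y. norm y \<le> 1}|\<mu> (h n). y)) \<le> K"
  obtains r b \<sigma> \<nu> c where "strict_mono (r :: nat \<Rightarrow> nat)" "levy_triplet b \<sigma> \<nu>" "c \<ge> 0"
    "generator_limit \<mu> (h \<circ> r) b \<sigma> \<nu> c"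
proof -
  define M where "M n = \<mu> (h n)" for n
  note M = prob[folded M_def] sets[folded M_def] h
  have bound': "1 / h n * ((LINT y|M n. levy_weight y) + norm (LINT y|M n. unit_ball_part y)) \<le> K" for n
    using bound[of n] by (simp add: M_def levy_weight_def unit_ball_part_def set_lebesgue_integral_def)
  have mass_bound: "(LINT y|M n. levy_weight y) / h n \<le> K" for n
  proof -
    have "0 \<le> norm (LINT y|M n. unit_ball_part y) / h n"
      using h[of n] by simp
    then show ?thesis
      using bound'[of n] by (simp add: add_divide_distrib)
  qed
  define \<rho> where "\<rho> n = weighted_measure (h n) (M n)" for n
  obtain r1 m R where r1: "strict_mono (r1 :: nat \<Rightarrow> nat)" and R: "finite_measure R" "sets R = sets borel"
    and mass: "(\<lambda>n. measure (\<rho> (r1 n)) UNIV) \<longlonglongrightarrow> m" "measure R UNIV \<le> m"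
    and vague: "\<And>(\<phi> :: real ^ 'n \<Rightarrow> real) S. continuous_on UNIV \<phi> \<Longrightarrow> (\<And>y. S \<le> norm y \<Longrightarrow> \<phi> y = 0) \<Longrightarrow>
      (\<lambda>n. integral\<^sup>L (\<rho> (r1 n)) \<phi>) \<longlonglongrightarrow> integral\<^sup>L R \<phi>"
  proof (rule vague_sequential_compactness[of \<rho> K])
    show "finite_measure (\<rho> n)" "sets (\<rho> n) = sets borel" "measure (\<rho> n) UNIV \<le> K" for n
      unfolding \<rho>_def using finite_measure_weighted_measure[OF M] sets_weighted_measure[OF M]
        measure_weighted_measure[OF M] mass_bound by simp_all
  qed blast
  define \<beta> where "\<beta> n = (1 / h n) *\<^sub>R (LINT y|M n. trunc y)" for n
  define A where "A n = scaled_second_moment (h n) (M n)" for n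
  have "bounded (range \<beta>)"
    unfolding \<beta>_def using norm_scaled_mean_le[OF M bound'] by (intro boundedI[of _ K]) auto
  moreover have "bounded (range A)"
    unfolding A_def using norm_scaled_second_moment_le[OF M mass_bound] by (intro boundedI) auto
  ultimately have "bounded (range \<beta> \<times> range A)"
    by (rule bounded_Times)
  \<comment> \<open>Pairing the means with the second moments lets a single extraction make both
    converge.\<close>
  then have "bounded (range (\<lambda>n. (\<beta> (r1 n), A (r1 n))))"
    by (rule bounded_subset) auto
  then obtain l r2 where r2: "strict_mono (r2 :: nat \<Rightarrow> nat)" "((\<lambda>n. (\<beta> (r1 n), A (r1 n))) \<circ> r2) \<longlonglongrightarrow> l"
    using bounded_imp_convergent_subsequence by blast
  define r where "r = r1 \<circ> r2"
  define b' where "b' = fst l"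
  define A' where "A' = snd l"
  have \<beta>_lim: "(\<lambda>n. \<beta> (r n)) \<longlonglongrightarrow> b'" and A_lim: "(\<lambda>n. A (r n)) \<longlonglongrightarrow> A'"
    using tendsto_fst[OF r2(2)] tendsto_snd[OF r2(2)] by (simp_all add: r_def b'_def A'_def comp_def)
  have mass_lim: "(\<lambda>n. measure (\<rho> (r n)) UNIV) \<longlonglongrightarrow> m"
    using LIMSEQ_subseq_LIMSEQ[OF mass(1) r2(1)] by (simp add: r_def comp_def)
  have vague': "(\<lambda>n. integral\<^sup>L (\<rho> (r n)) \<phi>) \<longlonglongrightarrow> integral\<^sup>L R \<phi>"
    if "continuous_on UNIV \<phi>" "\<And>y. S \<le> norm y \<Longrightarrow> \<phi> y = 0" for \<phi> :: "real ^ 'n \<Rightarrow> real" and S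
    using LIMSEQ_subseq_LIMSEQ[OF vague[OF that] r2(1)] by (simp add: r_def comp_def)
  have sym: "transpose A' = A'"
  proof -
    have "A n $ i $ j = A n $ j $ i" for n i j
      by (simp add: A_def scaled_second_moment_def mult.commute)
    then have "(\<lambda>n. A (r n) $ j $ i) \<longlonglongrightarrow> A' $ i $ j" for i j
      using tendsto_vec_nth[OF tendsto_vec_nth[OF A_lim], of i j] by simp
    then have "A' $ i $ j = A' $ j $ i" for i j
      using tendsto_vec_nth[OF tendsto_vec_nth[OF A_lim]] LIMSEQ_unique by blast
    then show ?thesis
      by (simp add: transpose_def vec_eq_iff)
  qed
  \<comment> \<open>Small jumps may concentrate at the origin in the limit, so the second moment of
    the limiting jumps can be strictly smaller than \<open>A'\<close>. The inequality is obtained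
    for each fixed \<open>\<delta>\<close> by letting \<open>n\<close> tend to infinity, and only
    then does \<open>\<delta>\<close> tend to 0.\<close>
  have psd: "u \<bullet> (jump_covariance R *v u) \<le> u \<bullet> (A' *v u)" for u
  proof (rule jump_covariance_quadratic_form_le[OF R])
    fix \<delta> :: real assume \<delta>: "\<delta> > 0"
    have "max (levy_weight y) \<delta> \<noteq> 0" for y :: "real ^ 'n"
      using \<delta> by (metis less_irrefl less_max_iff_disj)
    then have "(\<lambda>n. LINT y|\<rho> (r n). (u \<bullet> trunc y)\<^sup>2 / max (levy_weight y) \<delta>)
        \<longlonglongrightarrow> (LINT y|R. (u \<bullet> trunc y)\<^sup>2 / max (levy_weight y) \<delta>)"
      by (intro vague'[of _ 2] continuous_intros) (simp_all add: trunc_eq_0)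
    then show "(LINT y|R. (u \<bullet> trunc y)\<^sup>2 / max (levy_weight y) \<delta>) \<le> u \<bullet> (A' *v u)"
      by (rule LIMSEQ_le[OF _ tendsto_matrix_quadratic_form[OF A_lim]])
         (auto simp: \<rho>_def A_def intro: weighted_measure_quadratic_form_le[OF M \<delta>])
  qed
  have triplet: "levy_triplet (b' + jump_drift R) (A' - jump_covariance R) (jump_measure R)"
    unfolding levy_triplet_def sym_psd_def
  proof (intro conjI allI)
    show "transpose (A' - jump_covariance R) = A' - jump_covariance R"
      using sym by (simp add: transpose_def jump_covariance_def vec_eq_iff mult.commute)
    show "0 \<le> u \<bullet> ((A' - jump_covariance R) *v u)" for u
      using psd[of u] by (simp add: matrix_vector_mult_diff_rdistrib inner_diff_right)
    show "levy_measure (jump_measure R)"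
      by (rule levy_measure_jump_measure[OF R])
  qed
  have limit: "generator_limit \<mu> (h \<circ> r) (b' + jump_drift R) (A' - jump_covariance R) (jump_measure R) (m - measure R UNIV)"
    unfolding generator_limit_def
  proof (intro ballI allI)
    fix f :: "real ^ 'n \<Rightarrow> real" and x assume f: "f \<in> Cc2"
    obtain S where "\<And>y. S \<le> norm y \<Longrightarrow> taylor_quotient f x y = 0"
      using taylor_quotient_vanishes[OF f] by blast
    then have "(\<lambda>n. integral\<^sup>L (\<rho> (r n)) (taylor_quotient f x)) \<longlonglongrightarrow> integral\<^sup>L R (taylor_quotient f x)"
      by (rule vague'[OF continuous_taylor_quotient[OF f]])
    then have "(\<lambda>n. gradient f x \<bullet> \<beta> (r n)
        + 1/2 * (\<Sum>i\<in>UNIV. \<Sum>j\<in>UNIV. hessian f x $ i $ j * A (r n) $ i $ j)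
        - f x * measure (\<rho> (r n)) UNIV + integral\<^sup>L (\<rho> (r n)) (taylor_quotient f x))
      \<longlonglongrightarrow> gradient f x \<bullet> b' + 1/2 * (\<Sum>i\<in>UNIV. \<Sum>j\<in>UNIV. hessian f x $ i $ j * A' $ i $ j)
        - f x * m + integral\<^sup>L R (taylor_quotient f x)"
      by (intro tendsto_intros \<beta>_lim A_lim mass_lim)
    moreover have "(LINT y|\<mu> ((h \<circ> r) n). (f (x + y) - f x) / (h \<circ> r) n) = gradient f x \<bullet> \<beta> (r n)
        + 1/2 * (\<Sum>i\<in>UNIV. \<Sum>j\<in>UNIV. hessian f x $ i $ j * A (r n) $ i $ j)
        - f x * measure (\<rho> (r n)) UNIV + integral\<^sup>L (\<rho> (r n)) (taylor_quotient f x)" for n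
      unfolding comp_def \<beta>_def A_def \<rho>_def M_def[symmetric] by (rule difference_quotient_eq[OF M f])
    ultimately show "(\<lambda>n. LINT y|\<mu> ((h \<circ> r) n). (f (x + y) - f x) / (h \<circ> r) n) \<longlonglongrightarrow>
        levy_operator (b' + jump_drift R) (A' - jump_covariance R) (jump_measure R) f x
        - (m - measure R UNIV) * f x"
      unfolding levy_operator_eq[OF R f sym] by simp
  qed
  have "strict_mono r"
    unfolding r_def using r1 r2(1) by (rule strict_mono_o)
  from that[OF this triplet _ limit] show thesis
    using mass(2) by simp
qed

section \<open>The equivalence and the vanishing of the killing rate\<close>

lemma SUP_ereal_less_infinity_iff:
  fixes F :: "'a \<Rightarrow> real"
  shows "(SUP x\<in>S. ereal (F x)) < \<infinity> \<longleftrightarrow> (\<exists>K. \<forall>x\<in>S. F x \<le> K)"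
proof
  assume "(SUP x\<in>S. ereal (F x)) < \<infinity>"
  then obtain K where "(SUP x\<in>S. ereal (F x)) < ereal K"
    using less_PInf_Ex_of_nat by auto
  then have "ereal (F x) < ereal K" if "x \<in> S" for x
    using that by (meson SUP_upper le_less_trans)
  then show "\<exists>K. \<forall>x\<in>S. F x \<le> K"
    by (auto intro: less_imp_le)
next
  assume "\<exists>K. \<forall>x\<in>S. F x \<le> K"
  then obtain K where "\<forall>x\<in>S. F x \<le> K"
    by blast
  then have "(SUP x\<in>S. ereal (F x)) \<le> ereal K"
    by (intro SUP_least) simp
  then show "(SUP x\<in>S. ereal (F x)) < \<infinity>"
    by (rule le_less_trans) simp
qed

lemma null_seq_subseq:
  assumes "null_seq g" "strict_mono r"
  shows "null_seq (g \<circ> r)"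
  using assms LIMSEQ_subseq_LIMSEQ by (auto simp: null_seq_def)

lemma null_seq_at_right: "null_seq g \<Longrightarrow> filterlim g (at_right 0) sequentially"
  by (auto simp: null_seq_def filterlim_at less_imp_neq[symmetric] intro!: always_eventually)

theorem theorem3p4:
  fixes \<mu> :: "real \<Rightarrow> (real ^ 'n) measure"
  assumes "\<And>t. t > 0 \<Longrightarrow> prob_space (\<mu> t)"
    and "\<And>t. t > 0 \<Longrightarrow> sets (\<mu> t) = sets borel"
  shows "((\<exists>h0>0. (SUP h\<in>{0<..<h0}.
            ereal (1 / h * ((LINT y | \<mu> h. min 1 ((norm y)\<^sup>2)) +
                            norm (LINT y : {y. norm y \<le> 1} | \<mu> h. y)))) < \<infinity>)
          \<longleftrightarrow>
          (\<forall>g. null_seq g \<longrightarrow>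
            (\<exists>r. strict_mono r \<and>
              (\<exists>b \<sigma> \<nu> c. levy_triplet b \<sigma> \<nu> \<and> c \<ge> 0 \<and> generator_limit \<mu> (g \<circ> r) b \<sigma> \<nu> c))))
       \<and>
         ((\<exists>h0>0. (SUP h\<in>{0<..<h0}.
            ereal (1 / h * ((LINT y | \<mu> h. min 1 ((norm y)\<^sup>2)) +
                            norm (LINT y : {y. norm y \<le> 1} | \<mu> h. y)))) < \<infinity>)
          \<and> (\<forall>\<epsilon>>0. \<exists>M>0.
               Limsup (at_right 0) (\<lambda>h. ereal (1 / h * measure (\<mu> h) {y. norm y > M})) < ereal \<epsilon>)
          \<longrightarrow>
          (\<forall>g r b \<sigma> \<nu> c.
             null_seq g \<and> strict_mono r \<and> levy_triplet b \<sigma> \<nu> \<and> c \<ge> 0 \<and>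
             generator_limit \<mu> (g \<circ> r) b \<sigma> \<nu> c \<longrightarrow> c = 0))"
proof -
  define Q where "Q h = 1 / h * ((LINT y | \<mu> h. min 1 ((norm y)\<^sup>2)) +
    norm (LINT y : {y. norm y \<le> 1} | \<mu> h. y))" for h
  have bounded_eventually: "\<forall>\<^sub>F n in sequentially. Q (g n) \<le> K"
    if "null_seq g" "0 < h0" "\<forall>h\<in>{0<..<h0}. Q h \<le> K" for g h0 K
  proof -
    have "\<forall>\<^sub>F n in sequentially. g n < h0"
      using that(1,2) by (auto simp: null_seq_def intro: order_tendstoD(2))
    then show ?thesis
      by eventually_elim (use that in \<open>auto simp: null_seq_def\<close>)
  qed
  have fwd: "\<exists>r. strict_mono r \<and> (\<exists>b \<sigma> \<nu> c. levy_triplet b \<sigma> \<nu> \<and> c \<ge> 0 \<and> generator_limit \<mu> (g \<circ> r) b \<sigma> \<nu> c)"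
    if g: "null_seq g" and h0: "0 < h0" "\<forall>h\<in>{0<..<h0}. Q h \<le> K" for g h0 K
  proof -
    obtain N where N: "\<And>n. n \<ge> N \<Longrightarrow> Q (g n) \<le> K"
      using bounded_eventually[OF g h0] unfolding eventually_sequentially by blast
    \<comment> \<open>The moment bound holds only once \<open>g\<close> is below \<open>h0\<close>.
      Dropping the first \<open>N\<close> terms makes it hold throughout; the shift is put back into
      the subsequence index.\<close>
    define h where "h n = g (n + N)" for n
    have h_pos: "h n > 0" for n
      using g by (simp add: h_def null_seq_def)
    obtain r b \<sigma> \<nu> c where r: "strict_mono (r :: nat \<Rightarrow> nat)" "levy_triplet b \<sigma> \<nu>" "c \<ge> 0"
      "generator_limit \<mu> (h \<circ> r) b \<sigma> \<nu> c"
    proof (rule moments_bounded_imp_generator_limit[of h \<mu> K])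
      show "1 / h n * ((LINT y|\<mu> (h n). min 1 ((norm y)\<^sup>2)) + norm (LINT y:{y. norm y \<le> 1}|\<mu> (h n). y)) \<le> K" for n
        using N[of "n + N"] by (simp add: h_def Q_def)
    qed (use h_pos assms in blast)+
    have "strict_mono (\<lambda>n. r n + N)"
      using r(1) by (simp add: strict_mono_def)
    moreover have "h \<circ> r = g \<circ> (\<lambda>n. r n + N)"
      by (simp add: h_def fun_eq_iff)
    ultimately show ?thesis
      using r(2-4) by metis
  qed
  have bwd: "\<exists>h0>0. \<exists>K. \<forall>h\<in>{0<..<h0}. Q h \<le> K"
    if lim: "\<And>g. null_seq g \<Longrightarrow>
      \<exists>r. strict_mono r \<and> (\<exists>b \<sigma> \<nu> c. levy_triplet b \<sigma> \<nu> \<and> c \<ge> 0 \<and> generator_limit \<mu> (g \<circ> r) b \<sigma> \<nu> c)"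
  proof (rule ccontr)
    assume unbounded: "\<not> ?thesis"
    \<comment> \<open>Unboundedness near 0 yields a null sequence with
      \<open>Q (g n) > real n\<close>. Since \<open>r n \<ge> n\<close>, the quotient diverges along
      every subsequence too.\<close>
    have "\<exists>h\<in>{0<..<1 / real (Suc n)}. real n < Q h" for n
    proof -
      have "0 < 1 / real (Suc n)"
        by simp
      then show ?thesis
        using unbounded by (meson not_le)
    qed
    then obtain g where g: "\<And>n. g n \<in> {0<..<1 / real (Suc n)}" "\<And>n. real n < Q (g n)"
      by metis
    have "g \<longlonglongrightarrow> 0"
    proof (rule tendsto_sandwich[OF _ _ tendsto_const])
      show "(\<lambda>n. 1 / real (Suc n)) \<longlonglongrightarrow> 0"
        using LIMSEQ_inverse_real_of_nat by (simp add: inverse_eq_divide)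
    qed (use g(1) in \<open>auto intro!: always_eventually less_imp_le\<close>)
    then have "null_seq g"
      using g(1) by (auto simp: null_seq_def)
    then obtain r b \<sigma> \<nu> c where r: "strict_mono r" "generator_limit \<mu> (g \<circ> r) b \<sigma> \<nu> c"
      using lim by blast
    have pos: "0 < (g \<circ> r) n" for n
      using g(1) by simp
    obtain B where B: "\<And>n. Q ((g \<circ> r) n) \<le> B"
      unfolding Q_def
      by (rule generator_limit_imp_moments_bounded[OF pos assms(1)[OF pos] assms(2)[OF pos] r(2)]) blast
    obtain n where "B < real n"
      using reals_Archimedean2 by blast
    also have "real n \<le> real (r n)"
      using seq_suble[OF r(1)] by simp
    also have "\<dots> < Q (g (r n))"
      by (rule g(2))
    finally show False
      using B[of n] by simp
  qed
  have no_killing: "c = 0"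
    if h0: "0 < h0" "\<forall>h\<in>{0<..<h0}. Q h \<le> K"
      and tight: "\<And>\<epsilon>. \<epsilon> > 0 \<Longrightarrow>
        \<exists>M>0. Limsup (at_right 0) (\<lambda>h. ereal (1 / h * measure (\<mu> h) {y. norm y > M})) < ereal \<epsilon>"
      and g: "null_seq g" "strict_mono r"
      and L: "levy_triplet b \<sigma> \<nu>" "c \<ge> 0" "generator_limit \<mu> (g \<circ> r) b \<sigma> \<nu> c"
    for h0 K g r b \<sigma> \<nu> c
  proof -
    have null: "null_seq (g \<circ> r)"
      using g by (rule null_seq_subseq)
    have pos: "0 < (g \<circ> r) n" for n
      using null by (simp add: null_seq_def)
    show ?thesis
    proof (rule killing_rate_eq_0[OF pos assms(1)[OF pos] assms(2)[OF pos] _ _ _ L(3,2)])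
      show "levy_measure \<nu>"
        using L(1) by (simp add: levy_triplet_def)
      show "\<forall>\<^sub>F n in sequentially. 1 / (g \<circ> r) n * (LINT y|\<mu> ((g \<circ> r) n). min 1 ((norm y)\<^sup>2)) \<le> K"
        using bounded_eventually[OF null h0]
      proof eventually_elim
        case (elim n)
        \<comment> \<open>Discarding this nonnegative part of \<open>Q\<close> leaves the bound on
          the second moment.\<close>
        have "0 \<le> 1 / (g \<circ> r) n * norm (LINT y:{y. norm y \<le> 1}|\<mu> ((g \<circ> r) n). y)"
          using pos[of n] by simp
        then show ?case
          using elim unfolding Q_def distrib_left by linarith
      qed
      fix \<epsilon> :: real assume "\<epsilon> > 0"
      then obtain M where M: "M > 0"
        "Limsup (at_right 0) (\<lambda>h. ereal (1 / h * measure (\<mu> h) {y. norm y > M})) < ereal \<epsilon>"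
        using tight by blast
      have "\<forall>\<^sub>F h in at_right 0. 1 / h * measure (\<mu> h) {y. norm y > M} < \<epsilon>"
        using Limsup_lessD[OF M(2)] by simp
      then have "\<forall>\<^sub>F n in sequentially. 1 / (g \<circ> r) n * measure (\<mu> ((g \<circ> r) n)) {y. norm y > M} < \<epsilon>"
        using null_seq_at_right[OF null] by (rule eventually_compose_filterlim)
      then show "\<exists>M>0. \<forall>\<^sub>F n in sequentially. 1 / (g \<circ> r) n * measure (\<mu> ((g \<circ> r) n)) {y. norm y > M} < \<epsilon>"
        using M(1) by blast
    qed
  qed
  show ?thesis
    unfolding Q_def[symmetric] SUP_ereal_less_infinity_iff
    using fwd bwd no_killing by blast
qed

end
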